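(* Let $G$ be a nonsingular even integral symmetric $n\times n$ matrix ($n\ge1$), $N$ its level, $D=\det(G)$, $G^\perp=NG^{-1}$. Let $\mathbf{v}\in\mathbb{Z}^n$, $m\in\mathbb{Z}$, and $p$ a prime with $p\nmid D$. Let $r_{G,\mathbf{v}}(m)$ be the number of $\mathbf{x}\in\mathbb{Z}^n/p\mathbb{Z}^n$ with $\frac12\mathbf{x}^TG\mathbf{x}+\mathbf{v}^T\mathbf{x}\equiv m\pmod p$. Then: (1) If $2\mid n$ and $p>2$, then $r_{G,\mathbf{v}}(m)=p^{n-1}+\left(\frac{D}{p}\right)_K e\!\left(\frac{n(1-p)}{8}\right)p^{\frac n2-1}(\delta p-1)$, where $\delta=1$ if $Nm+\frac12\mathbf{v}^TG^\perp\mathbf{v}\equiv0\pmod p$ and $\delta=0$ otherwise. (2) If $2\mid n$ and $p=2$, then $r_{G,\mathbf{v}}(m)=2^{n-1}+\left(\frac{D}{2}\right)_K(-1)^{Nm+\frac12\mathbf{v}^TG^\perp\mathbf{v}}\,2^{\frac n2-1}$. (3) If $2\nmid n$, then $2\mid N$ (so $p>2$) and $r_{G,\mathbf{v}}(m)=p^{n-1}+\left(\frac{2D}{p}\right)_K\left(\frac{-t_m}{p}\right)_K e\!\left(\frac{(n+1)(1-p)}{8}\right)p^{\frac{n-1}{2}}$, where $t_m$ is any integer with $Nt_m\equiv Nm+\frac12\mathbf{v}^TG^\perp\mathbf{v}\pmod p$.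
   Context: $e(z)=\exp(2\pi i z)$. Even integral: integer entries with even diagonal. The level of $G$ is the least positive integer $N$ such that $NG^{-1}$ is even integral (note $p\nmid D$ iff $p\nmid N$). $(\frac{\cdot}{\cdot})_K$ is the Kronecker–Jacobi symbol. *)

theory Defs
  imports
    "HOL-Number_Theory.Number_Theory"
    "Jordan_Normal_Form.Determinant"
    "Jordan_Normal_Form.Gauss_Jordan_Elimination"
begin

definition e :: "complex \<Rightarrow> complex" where
  "e z = exp (2 * of_real pi * \<i> * z)"

definition kronecker_prime :: "int \<Rightarrow> int \<Rightarrow> int" where
  "kronecker_prime a p =
     (if p = 2 then (if even a then 0 else if a mod 8 \<in> {1, 7} then 1 else -1)
      else Legendre a p)"

text \<open>The Kronecker--Jacobi symbol, for an arbitrary integer denominator: it is multiplicative in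
  the denominator, and the factor belonging to the unit -1 is the sign of the numerator
  (with sign +1 for the numerator 0).\<close>

definition kronecker :: "int \<Rightarrow> int \<Rightarrow> int" where
  "kronecker a b =
     (if b = 0 then (if \<bar>a\<bar> = 1 then 1 else 0)
      else (if b < 0 \<and> a < 0 then -1 else 1) *
        (\<Prod>q\<in>#prime_factorization \<bar>b\<bar>. kronecker_prime a q))"

definition even_integral :: "int mat \<Rightarrow> bool" where
  "even_integral A \<longleftrightarrow> square_mat A \<and> (\<forall>i < dim_row A. even (A $$ (i, i)))"

text \<open>The predicate holds if the integer matrix \<open>H\<close> equals \<open>N G\<inverse>\<close>, the inverse being taken
  over the rationals.  It is only meaningful for nonsingular \<open>G\<close>.\<close>

definition is_scaled_inverse :: "int mat \<Rightarrow> nat \<Rightarrow> int mat \<Rightarrow> bool" where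
  "is_scaled_inverse G N H \<longleftrightarrow>
     map_mat rat_of_int H = of_nat N \<cdot>\<^sub>m the (mat_inverse (map_mat rat_of_int G))"

definition level :: "int mat \<Rightarrow> nat" where
  "level G = (LEAST N. N > 0 \<and> (\<exists>H. is_scaled_inverse G N H \<and> even_integral H))"

definition G_perp :: "int mat \<Rightarrow> int mat" where
  "G_perp G = (THE H. is_scaled_inverse G (level G) H)"

text \<open>For an even integral symmetric matrix the quadratic form takes even values on integer vectors,
  so the division is exact.\<close>

definition half_form :: "int mat \<Rightarrow> int vec \<Rightarrow> int" where
  "half_form A x = (x \<bullet> (A *\<^sub>v x)) div 2"

text \<open>The elements of \<open>\<int>\<^sup>n / p\<int>\<^sup>n\<close> are represented by the vectors with all entries in
  \<open>{0..<p}\<close>.\<close>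

definition rep_count :: "int mat \<Rightarrow> int vec \<Rightarrow> nat \<Rightarrow> int \<Rightarrow> nat" where
  "rep_count G v p m =
     card {x \<in> carrier_vec (dim_row G).
       (\<forall>i < dim_row G. x $ i \<in> {0..<int p}) \<and>
       [half_form G x + v \<bullet> x = m] (mod int p)}"

end

theory Submission
  imports Defs
begin

text \<open>Orthogonality of the additive characters modulo \<open>p\<close> expresses \<open>p\<close> times the count
  through the quadratic Gauss sums of \<open>G\<close>.  Such a sum is multiplicative on orthogonal sums and
  invariant under \<open>G \<mapsto> P\<^sup>T G P\<close> whenever \<open>det P\<close> is prime to \<open>p\<close>.  Over the integers, such a \<open>P\<close>
  splits off from \<open>G\<close> a block of size 1 (\<open>p > 2\<close>) or 2 (\<open>p = 2\<close>) whose determinant is prime to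
  \<open>p\<close>, and induction leaves one-variable Gauss sums, or four-term sums when \<open>p = 2\<close>.
  For \<open>p = 2\<close> the same induction shows that an even symmetric matrix of odd determinant has even
  size.  The linear term is removed by the translation \<open>w \<equiv> G\<inverse> v\<close> modulo \<open>p\<close>.\<close>

section \<open>Gauss sums modulo a prime\<close>

text \<open>The sign of the one-variable sum \<open>gauss_sum p 1\<close> is never determined; its
  square suffices. For even n the n-th power occurs. For odd n the quadratic character of the
  frequency survives, and summing over the frequencies yields one more Gauss sum, so the power is n
  + 1. The root of unity in the formulas is therefore only a sign, a power of the Legendre symbol of
  -1.

  Ordinary block elimination would divide by the determinant of the leading block. Working modulo p
  instead would lose information at p = 2, because half of the quadratic form modulo 2 depends on
  the diagonal of G modulo 4. So the matrices stay integral and the denominators are cleared. This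
  changes the determinant by the square of a unit modulo p, which the Legendre and Kronecker symbols
  do not see.

  After the translation the linear form is gone and m is replaced by a constant c with N c = k
  modulo p, where k is the quantity in the theorem. Passing between c and k requires N to be a unit
  modulo p, which is why the level must be studied.\<close>

definition add_char :: "nat \<Rightarrow> int \<Rightarrow> complex" where
  "add_char p a = cis (2 * pi * of_int a / of_nat p)"

lemma add_char_0 [simp]: "add_char p 0 = 1"
  by (simp add: add_char_def)

lemma add_char_add: "add_char p (a + b) = add_char p a * add_char p b"
  by (simp add: add_char_def cis_mult add_divide_distrib distrib_left)

lemma add_char_multiple [simp]:
  assumes "p > 0"
  shows "add_char p (int p * k) = 1"
proof -
  have "2 * pi * of_int (int p * k) / of_nat p = 2 * pi * of_int k"
    using assms by simp
  then show ?thesis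
    unfolding add_char_def by (simp only: cis_multiple_2pi Ints_of_int)
qed

lemma add_char_cong:
  assumes "p > 0" "[a = b] (mod int p)"
  shows "add_char p a = add_char p b"
proof -
  obtain k where "a = b + int p * k"
    using assms(2) by (metis cong_iff_lin cong_sym)
  then show ?thesis using assms(1) by (simp add: add_char_add)
qed

lemma add_char_eq_1_iff:
  assumes "p > 0"
  shows "add_char p a = 1 \<longleftrightarrow> [a = 0] (mod int p)"
proof
  assume "add_char p a = 1"
  then have "cos (2 * pi * of_int a / of_nat p) = 1"
    by (simp add: add_char_def complex_eq_iff)
  then obtain k :: int where "2 * pi * of_int a / of_nat p = of_int k * 2 * pi"
    by (auto simp: cos_one_2pi_int)
  then have "real_of_int a = of_int (k * int p)"
    using assms by (simp add: field_simps)
  then have "a = k * int p" by linarith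
  then show "[a = 0] (mod int p)" by (simp add: cong_def)
next
  assume "[a = 0] (mod int p)"
  then show "add_char p a = 1" using add_char_cong[OF assms] by fastforce
qed

text \<open>Multiplication by a unit followed by a shift permutes the residue classes. Periodicity
  of \<open>f\<close> is needed because \<open>a * t + b\<close> leaves the interval of
  representatives.\<close>

lemma sum_residues_affine:
  fixes f :: "int \<Rightarrow> 'a::comm_monoid_add"
  assumes "p > 0" "coprime a (int p)"
    and f: "\<And>s t. [s = t] (mod int p) \<Longrightarrow> f s = f t"
  shows "(\<Sum>t\<in>{0..<int p}. f (a * t + b)) = (\<Sum>t\<in>{0..<int p}. f t)"
proof -
  let ?h = "\<lambda>t. (a * t + b) mod int p"
  have "inj_on ?h {0..<int p}"
  proof (rule inj_onI)
    fix s t assume st: "s \<in> {0..<int p}" "t \<in> {0..<int p}" "?h s = ?h t"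
    then have "[a * s = a * t] (mod int p)"
      by (simp add: cong_def[symmetric] cong_add_rcancel)
    then have "[s = t] (mod int p)"
      using assms(2) by (simp add: cong_mult_lcancel)
    then show "s = t" using st by (simp add: cong_def)
  qed
  moreover have "?h ` {0..<int p} \<subseteq> {0..<int p}" using assms(1) by auto
  ultimately have bij: "bij_betw ?h {0..<int p} {0..<int p}"
    by (simp add: bij_betw_def endo_inj_surj)
  have "(\<Sum>t\<in>{0..<int p}. f (a * t + b)) = (\<Sum>t\<in>{0..<int p}. f (?h t))"
    by (intro sum.cong refl f) (simp add: cong_def)
  also have "\<dots> = (\<Sum>t\<in>{0..<int p}. f t)"
    by (rule sum.reindex_bij_betw[OF bij])
  finally show ?thesis .
qed

text \<open>Shifting \<open>t\<close> by 1 permutes the residues and multiplies the sum by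
  \<open>add_char p a\<close>; unless this factor is 1, the sum vanishes.\<close>

lemma sum_add_char:
  assumes "p > 0"
  shows "(\<Sum>t\<in>{0..<int p}. add_char p (a * t)) = (if [a = 0] (mod int p) then of_nat p else 0)"
proof (cases "[a = 0] (mod int p)")
  case True
  then have "add_char p (a * t) = 1" for t
    using assms by (metis add_char_eq_1_iff cong_mult_self_right cong_scalar_right mult_zero_left)
  then show ?thesis using True by simp
next
  case False
  let ?S = "\<Sum>t\<in>{0..<int p}. add_char p (a * t)"
  have "?S = (\<Sum>t\<in>{0..<int p}. add_char p (a * (1 * t + 1)))"
    by (rule sum_residues_affine[symmetric, OF assms])
       (auto intro!: add_char_cong assms cong_scalar_left)
  also have "\<dots> = ?S * add_char p a"
    by (simp add: distrib_left add_char_add sum_distrib_right)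
  finally have "?S * (1 - add_char p a) = 0" by (simp add: algebra_simps)
  then show ?thesis using False add_char_eq_1_iff[OF assms, of a] by auto
qed

section \<open>The Legendre symbol and counting square roots\<close>

lemma Legendre_cong:
  assumes "[a = b] (mod p)"
  shows "Legendre a p = Legendre b p"
proof -
  have "[a = 0] (mod p) \<longleftrightarrow> [b = 0] (mod p)"
    using assms cong_sym cong_trans by blast
  moreover have "QuadRes p a \<longleftrightarrow> QuadRes p b"
    unfolding QuadRes_def using assms cong_sym cong_trans by blast
  ultimately show ?thesis by (simp add: Legendre_def)
qed

text \<open>Two such values differ by at most 2, which is less than \<open>p\<close>. This turns the
  congruences of Euler's criterion into equalities of symbols.\<close>

lemma eq_if_cong_sign:
  fixes a b :: int
  assumes "a \<in> {-1, 0, 1}" "b \<in> {-1, 0, 1}" "p > 2" "[a = b] (mod int p)"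
  shows "a = b"
proof -
  have "int p dvd a - b" using assms(4) by (simp add: cong_iff_dvd_diff)
  moreover have "\<bar>a - b\<bar> < int p" using assms(1-3) by auto
  ultimately show ?thesis using zdvd_not_zless[of "\<bar>a - b\<bar>" "int p"] by fastforce
qed

lemma Legendre_square:
  assumes "\<not> [a = 0] (mod p)"
  shows "Legendre a p * Legendre a p = 1"
  using assms by (simp add: Legendre_def)

lemma Legendre_mult:
  assumes "prime p" "p > 2"
  shows "Legendre (a * b) (int p) = Legendre a (int p) * Legendre b (int p)"
proof (rule eq_if_cong_sign[OF _ _ assms(2)])
  have "[Legendre (a * b) (int p) = (a * b) ^ ((p - 1) div 2)] (mod int p)"
    by (rule euler_criterion[OF assms])
  also have "(a * b) ^ ((p - 1) div 2) = a ^ ((p - 1) div 2) * b ^ ((p - 1) div 2)"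
    by (rule power_mult_distrib)
  also have "[\<dots> = Legendre a (int p) * Legendre b (int p)] (mod int p)"
    by (intro cong_mult cong_sym[OF euler_criterion] assms)
  finally show "[Legendre (a * b) (int p) = Legendre a (int p) * Legendre b (int p)] (mod int p)" .
qed (auto simp: Legendre_def)

lemma Legendre_minus_1:
  assumes "prime p" "p > 2"
  shows "Legendre (- 1) (int p) = (- 1) ^ ((p - 1) div 2)"
proof (rule eq_if_cong_sign[OF _ _ assms(2) euler_criterion[OF assms]])
  show "(- 1) ^ ((p - 1) div 2) \<in> {- 1, 0, 1 :: int}"
    by (cases "even ((p - 1) div 2)") auto
qed (auto simp: Legendre_def)

lemma Legendre_power:
  assumes "prime p" "p > 2"
  shows "Legendre (a ^ n) (int p) = Legendre a (int p) ^ n"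
proof (induction n)
  case 0
  have "\<not> [1 = 0] (mod int p)" using assms(2) by (simp add: cong_def)
  then have "Legendre 1 (int p) = 1"
    unfolding Legendre_def QuadRes_def by (metis cong_refl one_power2)
  then show ?case by simp
qed (simp add: Legendre_mult assms)

text \<open>If \<open>y\<close> is one root, the roots are the classes of \<open>y\<close> and
  \<open>- y\<close>, and these coincide exactly when \<open>p\<close> divides \<open>2 * y\<close>,
  that is, when \<open>p\<close> divides \<open>t\<close>.\<close>

lemma card_square_roots_mod:
  assumes "prime p" "p > 2"
  shows "int (card {x\<in>{0..<int p}. [x\<^sup>2 = t] (mod int p)}) = 1 + Legendre t (int p)"
proof -
  have p: "prime (int p)" using assms(1) by simp
  have roots: "[x\<^sup>2 = y\<^sup>2] (mod int p) \<longleftrightarrow> [x = y] (mod int p) \<or> [x = - y] (mod int p)" for x y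
  proof -
    have "x\<^sup>2 - y\<^sup>2 = (x - y) * (x + y)" by (simp add: power2_eq_square algebra_simps)
    then show ?thesis using prime_dvd_mult_iff[OF p] by (simp add: cong_iff_dvd_diff)
  qed
  show ?thesis
  proof (cases "QuadRes (int p) t")
    case False
    then have "{x\<in>{0..<int p}. [x\<^sup>2 = t] (mod int p)} = {}"
      by (auto simp: QuadRes_def)
    moreover have "\<not> [t = 0] (mod int p)"
      using False unfolding QuadRes_def by (metis cong_sym power_zero_numeral)
    ultimately show ?thesis using False by (simp only: Legendre_def) simp
  next
    case True
    then obtain y where y: "[y\<^sup>2 = t] (mod int p)" by (auto simp: QuadRes_def)
    have "{x\<in>{0..<int p}. [x\<^sup>2 = t] (mod int p)} = {x\<in>{0..<int p}. [x\<^sup>2 = y\<^sup>2] (mod int p)}"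
      using y cong_sym cong_trans by blast
    also have "\<dots> = {y mod int p, - y mod int p}"
    proof -
      have "x = a mod int p \<longleftrightarrow> x \<in> {0..<int p} \<and> [x = a] (mod int p)" for x a
        using assms(2) by (auto simp: cong_def)
      then show ?thesis unfolding roots by blast
    qed
    finally have eq: "{x\<in>{0..<int p}. [x\<^sup>2 = t] (mod int p)} = {y mod int p, - y mod int p}" .
    have "y mod int p = - y mod int p \<longleftrightarrow> int p dvd 2 * y"
      by (simp add: mod_eq_dvd_iff)
    also have "\<dots> \<longleftrightarrow> int p dvd y"
    proof -
      have "\<not> int p dvd 2" using assms(2) by (auto dest: zdvd_imp_le)
      then show ?thesis using prime_dvd_mult_iff[OF p] by blast
    qed
    also have "\<dots> \<longleftrightarrow> int p dvd y\<^sup>2" using prime_dvd_power_iff[OF p] by simp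
    also have "\<dots> \<longleftrightarrow> [t = 0] (mod int p)" using y by (metis cong_0_iff cong_sym cong_trans)
    finally have "card {y mod int p, - y mod int p} = (if [t = 0] (mod int p) then 1 else 2)"
      by (simp add: card_insert_if)
    then show ?thesis unfolding eq using True by (simp add: Legendre_def)
  qed
qed

text \<open>Grouping by the value of the square, the fibre over \<open>t\<close> has
  \<open>1 + Legendre t p\<close> elements.\<close>

lemma sum_over_squares:
  fixes f :: "int \<Rightarrow> complex"
  assumes "prime p" "p > 2"
    and f: "\<And>s t. [s = t] (mod int p) \<Longrightarrow> f s = f t"
  shows "(\<Sum>x\<in>{0..<int p}. f (x\<^sup>2)) = (\<Sum>t\<in>{0..<int p}. (1 + of_int (Legendre t (int p))) * f t)"
proof -
  have "(\<Sum>x\<in>{0..<int p}. f (x\<^sup>2)) = (\<Sum>x\<in>{0..<int p}. f (x\<^sup>2 mod int p))"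
    by (intro sum.cong refl f) (simp add: cong_def)
  also have "\<dots> = (\<Sum>t\<in>{0..<int p}. \<Sum>x\<in>{x\<in>{0..<int p}. x\<^sup>2 mod int p = t}. f (x\<^sup>2 mod int p))"
    by (rule sum.group[symmetric]) (use assms(2) in auto)
  also have "\<dots> = (\<Sum>t\<in>{0..<int p}. of_nat (card {x\<in>{0..<int p}. [x\<^sup>2 = t] (mod int p)}) * f t)"
  proof (rule sum.cong[OF refl])
    fix t assume t: "t \<in> {0..<int p}"
    then have "{x\<in>{0..<int p}. [x\<^sup>2 = t] (mod int p)} = {x\<in>{0..<int p}. x\<^sup>2 mod int p = t}"
      by (simp add: cong_def)
    then show "(\<Sum>x\<in>{x\<in>{0..<int p}. x\<^sup>2 mod int p = t}. f (x\<^sup>2 mod int p)) =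
      of_nat (card {x\<in>{0..<int p}. [x\<^sup>2 = t] (mod int p)}) * f t"
      by simp
  qed
  also have "\<dots> = (\<Sum>t\<in>{0..<int p}. (1 + of_int (Legendre t (int p))) * f t)"
  proof (rule sum.cong[OF refl])
    fix t
    have "of_nat (card {x\<in>{0..<int p}. [x\<^sup>2 = t] (mod int p)}) =
      (of_int (int (card {x\<in>{0..<int p}. [x\<^sup>2 = t] (mod int p)})) :: complex)" by simp
    also have "\<dots> = 1 + of_int (Legendre t (int p))"
      unfolding card_square_roots_mod[OF assms(1,2)] by simp
    finally show "of_nat (card {x\<in>{0..<int p}. [x\<^sup>2 = t] (mod int p)}) * f t =
      (1 + of_int (Legendre t (int p))) * f t" by (rule arg_cong)
  qed
  finally show ?thesis .
qed

section \<open>One-variable Gauss sums\<close>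

text \<open>The form twisted by the quadratic character is chosen instead of the sum over squares:
  it vanishes when \<open>p\<close> divides \<open>a\<close>, so that \<open>gauss_sum_eq\<close>
  holds for every \<open>a\<close>. In odd dimension it is evaluated at a number that
  \<open>p\<close> may divide.\<close>

definition gauss_sum :: "nat \<Rightarrow> int \<Rightarrow> complex" where
  "gauss_sum p a = (\<Sum>t\<in>{0..<int p}. of_int (Legendre t (int p)) * add_char p (a * t))"

lemma gauss_sum_eq:
  assumes "prime p" "p > 2"
  shows "gauss_sum p a = of_int (Legendre a (int p)) * gauss_sum p 1"
proof (cases "[a = 0] (mod int p)")
  case True
  \<comment> \<open>For the constant function 1, \<open>sum_over_squares\<close> reads p = p + (sum
    of all Legendre symbols).\<close>
  have "(\<Sum>t\<in>{0..<int p}. of_int (Legendre t (int p))) = (0 :: complex)"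
    using sum_over_squares[OF assms, of "\<lambda>_. 1"] by (simp add: sum.distrib)
  moreover have "add_char p (a * t) = 1" for t
  proof -
    have "[a * t = 0 * t] (mod int p)" using True by (rule cong_scalar_right)
    then show ?thesis using assms(2) by (simp add: add_char_eq_1_iff)
  qed
  ultimately show ?thesis using True by (simp add: gauss_sum_def Legendre_def)
next
  case False
  then have cop: "coprime a (int p)"
    using assms(1) prime_imp_coprime[of "int p" a] by (simp add: cong_0_iff coprime_commute)
  let ?f = "\<lambda>t. of_int (Legendre t (int p)) * add_char p t"
  have "gauss_sum p a = (\<Sum>t\<in>{0..<int p}. of_int (Legendre a (int p)) * ?f (a * t + 0))"
    unfolding gauss_sum_def
  proof (rule sum.cong[OF refl])
    fix t
    have "Legendre t (int p) = Legendre a (int p) * Legendre (a * t) (int p)"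
      using Legendre_square[OF False] by (simp add: Legendre_mult[OF assms] mult.assoc[symmetric])
    then show "of_int (Legendre t (int p)) * add_char p (a * t) =
      of_int (Legendre a (int p)) * ?f (a * t + 0)" by simp
  qed
  also have "\<dots> = of_int (Legendre a (int p)) * (\<Sum>t\<in>{0..<int p}. ?f t)"
    unfolding sum_distrib_left[symmetric]
  proof (rule arg_cong[where f = "(*) (of_int (Legendre a (int p)))"], rule sum_residues_affine[OF _ cop])
    show p: "p > 0" using assms(2) by simp
    show "?f s = ?f t" if "[s = t] (mod int p)" for s t
      using Legendre_cong[OF that] add_char_cong[OF p that] by simp
  qed
  finally show ?thesis by (simp add: gauss_sum_def)
qed

text \<open>The sum of \<open>gauss_sum p a * gauss_sum p (- a)\<close> over all \<open>a\<close> is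
  computed twice. By \<open>gauss_sum_eq\<close> it is p - 1 times the symbol of -1 times the square
  sought. Expanded, orthogonality in \<open>a\<close> leaves only the diagonal \<open>s = t\<close>,
  which gives (p - 1) p.\<close>

lemma gauss_sum_square:
  assumes "prime p" "p > 2"
  shows "gauss_sum p 1 ^ 2 = of_int (Legendre (- 1) (int p)) * of_nat p"
proof -
  let ?L = "\<lambda>a. of_int (Legendre a (int p)) :: complex"
  let ?R = "{0..<int p}"
  have p: "p > 0" using assms(2) by simp
  have sq: "?L a * ?L a = (if a = 0 then 0 else 1)" if "a \<in> ?R" for a
  proof -
    have "[a = 0] (mod int p) \<longleftrightarrow> a = 0" using that by (auto simp: cong_def)
    then show ?thesis by (simp add: Legendre_def)
  qed
  have "(\<Sum>a\<in>?R. ?L a * ?L a) = (\<Sum>a\<in>?R. if a = 0 then 0 else 1)"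
    by (rule sum.cong[OF refl sq])
  also have "\<dots> = (\<Sum>a\<in>?R. 1 - (if a = 0 then 1 else 0))"
    by (rule sum.cong) auto
  also have "\<dots> = of_nat p - 1"
    using p by (simp only: sum_subtractf) simp
  finally have sumsq: "(\<Sum>a\<in>?R. ?L a * ?L a) = of_nat p - 1" .
  have "(\<Sum>a\<in>?R. gauss_sum p a * gauss_sum p (- a)) =
      (\<Sum>a\<in>?R. (?L a * ?L a) * (?L (- 1) * gauss_sum p 1 ^ 2))"
  proof (rule sum.cong[OF refl])
    fix a
    have "?L (- a) = ?L (- 1) * ?L a"
      using Legendre_mult[OF assms, of "- 1" a] by simp
    then show "gauss_sum p a * gauss_sum p (- a) = (?L a * ?L a) * (?L (- 1) * gauss_sum p 1 ^ 2)"
      by (simp add: gauss_sum_eq[OF assms, of a] gauss_sum_eq[OF assms, of "- a"] power2_eq_square)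
  qed
  then have 1: "(\<Sum>a\<in>?R. gauss_sum p a * gauss_sum p (- a)) =
      (of_nat p - 1) * (?L (- 1) * gauss_sum p 1 ^ 2)"
    by (simp add: sum_distrib_right[symmetric] sumsq)
  have "(\<Sum>a\<in>?R. gauss_sum p a * gauss_sum p (- a)) =
      (\<Sum>a\<in>?R. \<Sum>s\<in>?R. \<Sum>t\<in>?R. ?L s * ?L t * add_char p ((s - t) * a))"
    unfolding gauss_sum_def sum_product
    by (intro sum.cong refl) (simp add: add_char_add[symmetric] algebra_simps)
  also have "\<dots> = (\<Sum>s\<in>?R. \<Sum>t\<in>?R. \<Sum>a\<in>?R. ?L s * ?L t * add_char p ((s - t) * a))"
    by (subst sum.swap, rule sum.cong[OF refl], rule sum.swap)
  also have "\<dots> = (\<Sum>s\<in>?R. \<Sum>t\<in>?R. if t = s then ?L s * ?L s * of_nat p else 0)"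
  proof (intro sum.cong refl)
    fix s t assume st: "s \<in> ?R" "t \<in> ?R"
    have "[s - t = 0] (mod int p) \<longleftrightarrow> t = s"
      using st by (auto simp: cong_0_iff mod_eq_dvd_iff[symmetric])
    then show "(\<Sum>a\<in>?R. ?L s * ?L t * add_char p ((s - t) * a)) =
        (if t = s then ?L s * ?L s * of_nat p else 0)"
      by (simp add: sum_distrib_left[symmetric] sum_add_char[OF p])
  qed
  also have "\<dots> = (\<Sum>s\<in>?R. ?L s * ?L s) * of_nat p"
    by (simp add: sum_distrib_right)
  finally have "(of_nat p - 1) * (?L (- 1) * gauss_sum p 1 ^ 2) = (of_nat p - 1) * of_nat p"
    unfolding 1 sumsq .
  moreover have "(of_nat p - 1 :: complex) \<noteq> 0"
    using assms(2) by simp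
  ultimately have "?L (- 1) * gauss_sum p 1 ^ 2 = of_nat p" by simp
  then have "(?L (- 1) * ?L (- 1)) * gauss_sum p 1 ^ 2 = ?L (- 1) * of_nat p"
    by (simp only: mult.assoc)
  moreover have "?L (- 1) * ?L (- 1) = 1"
  proof -
    have "\<not> [- 1 = 0] (mod int p)" using assms(2) by (simp add: cong_0_iff)
    then show ?thesis using Legendre_square by (metis of_int_1 of_int_mult)
  qed
  ultimately show ?thesis by simp
qed

text \<open>In the weight \<open>1 + Legendre t p\<close> of \<open>sum_over_squares\<close>, the
  summand 1 contributes a full character sum, which vanishes because \<open>p\<close> does not
  divide \<open>a\<close>.\<close>

lemma sum_add_char_square:
  assumes "prime p" "p > 2" "\<not> int p dvd a"
  shows "(\<Sum>x\<in>{0..<int p}. add_char p (a * x\<^sup>2)) = of_int (Legendre a (int p)) * gauss_sum p 1"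
proof -
  have p: "p > 0" using assms(2) by simp
  have "(\<Sum>x\<in>{0..<int p}. add_char p (a * x\<^sup>2)) =
      (\<Sum>t\<in>{0..<int p}. (1 + of_int (Legendre t (int p))) * add_char p (a * t))"
    using assms(1,2) by (rule sum_over_squares) (auto intro!: add_char_cong p cong_scalar_left)
  also have "\<dots> = (\<Sum>t\<in>{0..<int p}. add_char p (a * t)) + gauss_sum p a"
    by (simp add: gauss_sum_def distrib_right sum.distrib)
  also have "\<dots> = gauss_sum p a"
    using assms(3) by (simp add: sum_add_char[OF p] cong_0_iff)
  finally show ?thesis using gauss_sum_eq[OF assms(1,2), of a] by (rule trans)
qed

section \<open>Quadratic Gauss sums of even symmetric matrices\<close>

definition residue_box :: "nat \<Rightarrow> nat \<Rightarrow> int vec set" where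
  "residue_box n p = {x \<in> carrier_vec n. \<forall>i<n. x $ i \<in> {0..<int p}}"

definition vec_cong :: "int vec \<Rightarrow> int vec \<Rightarrow> int \<Rightarrow> bool" where
  "vec_cong x y m \<longleftrightarrow> dim_vec x = dim_vec y \<and> (\<forall>i<dim_vec x. [x $ i = y $ i] (mod m))"

lemma finite_residue_box: "finite (residue_box n p)"
proof (rule finite_subset)
  show "residue_box n p \<subseteq> vec_of_list ` {xs. set xs \<subseteq> {0..<int p} \<and> length xs = n}"
  proof
    fix x assume x: "x \<in> residue_box n p"
    then have "set (list_of_vec x) \<subseteq> {0..<int p}" "length (list_of_vec x) = n"
      by (auto simp: residue_box_def set_list_of_vec vec_set_def)
    then show "x \<in> vec_of_list ` {xs. set xs \<subseteq> {0..<int p} \<and> length xs = n}"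
      by (metis (mono_tags, lifting) imageI mem_Collect_eq vec_list)
  qed
qed (simp add: finite_lists_length_eq)

lemma residue_box_carrier: "x \<in> residue_box n p \<Longrightarrow> x \<in> carrier_vec n"
  by (simp add: residue_box_def)

lemma residue_box_0: "residue_box 0 p = {vNil}"
proof -
  have "x = vNil" if "x \<in> carrier_vec 0" for x :: "int vec"
    using that by (intro eq_vecI) auto
  then show ?thesis by (auto simp: residue_box_def)
qed

lemma residue_box_append:
  "bij_betw (\<lambda>(x, y). x @\<^sub>v y) (residue_box r p \<times> residue_box s p) (residue_box (r + s) p)"
proof (rule bij_betw_byWitness[where f' = "\<lambda>x. (vec_first x r, vec_last x s)"])
  show "\<forall>a\<in>residue_box r p \<times> residue_box s p. (\<lambda>x. (vec_first x r, vec_last x s)) (case a of (x, y) \<Rightarrow> x @\<^sub>v y) = a"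
    by (auto simp: residue_box_def vec_first_def vec_last_def intro!: eq_vecI)
  show "\<forall>a\<in>residue_box (r + s) p. (case (\<lambda>x. (vec_first x r, vec_last x s)) a of (x, y) \<Rightarrow> x @\<^sub>v y) = a"
    by (auto simp: residue_box_def)
  show "(\<lambda>(x, y). x @\<^sub>v y) ` (residue_box r p \<times> residue_box s p) \<subseteq> residue_box (r + s) p"
    by (auto simp: residue_box_def)
  show "(\<lambda>x. (vec_first x r, vec_last x s)) ` residue_box (r + s) p \<subseteq> residue_box r p \<times> residue_box s p"
    by (auto simp: residue_box_def vec_first_def vec_last_def)
qed

lemma sum_residue_box_append:
  "sum f (residue_box (r + s) p) = (\<Sum>x\<in>residue_box r p. \<Sum>y\<in>residue_box s p. f (x @\<^sub>v y))"
proof -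
  have "sum f (residue_box (r + s) p) = (\<Sum>z\<in>residue_box r p \<times> residue_box s p. f (case z of (x, y) \<Rightarrow> x @\<^sub>v y))"
    by (rule sum.reindex_bij_betw[symmetric, OF residue_box_append])
  also have "\<dots> = (\<Sum>x\<in>residue_box r p. \<Sum>y\<in>residue_box s p. f (x @\<^sub>v y))"
    by (simp add: sum.cartesian_product case_prod_unfold)
  finally show ?thesis .
qed

lemma sum_residue_box_1:
  "sum f (residue_box 1 p) = (\<Sum>x\<in>{0..<int p}. f (vec 1 (\<lambda>_. x)))"
proof -
  have "bij_betw (\<lambda>x. vec 1 (\<lambda>_. x)) {0..<int p} (residue_box 1 p)"
    by (rule bij_betw_byWitness[where f' = "\<lambda>x. x $ 0"])
       (auto simp: residue_box_def intro!: eq_vecI)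
  then show ?thesis by (rule sum.reindex_bij_betw[symmetric])
qed

lemma sum_residue_box_2:
  "sum f (residue_box 2 p) =
    (\<Sum>x\<in>{0..<int p}. \<Sum>y\<in>{0..<int p}. f (vec 2 (\<lambda>i. if i = 0 then x else y)))"
proof -
  have "vec 1 (\<lambda>_. x) @\<^sub>v vec 1 (\<lambda>_. y) = vec 2 (\<lambda>i. if i = 0 then x else y)" for x y :: int
    by (intro eq_vecI) auto
  then show ?thesis
    using sum_residue_box_append[of f 1 1 p] by (simp only: sum_residue_box_1 one_add_one)
qed

lemma vec_cong_sym: "vec_cong x y m \<Longrightarrow> vec_cong y x m"
  unfolding vec_cong_def by (auto intro: cong_sym)

lemma vec_cong_trans: "vec_cong x y m \<Longrightarrow> vec_cong y z m \<Longrightarrow> vec_cong x z m"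
  unfolding vec_cong_def by (metis cong_trans)

lemma scalar_prod_cong:
  assumes "vec_cong x y m" "vec_cong u w m" "dim_vec u = dim_vec x"
  shows "[x \<bullet> u = y \<bullet> w] (mod m)"
  using assms unfolding scalar_prod_def vec_cong_def
  by (auto intro!: cong_sum cong_mult)

lemma mult_mat_vec_cong:
  assumes "vec_cong x y m" "dim_col A = dim_vec x"
  shows "vec_cong (A *\<^sub>v x) (A *\<^sub>v y) m"
  unfolding vec_cong_def
  using assms by (auto intro!: scalar_prod_cong simp: vec_cong_def)

lemma residue_box_eq_if_cong:
  assumes "x \<in> residue_box n p" "y \<in> residue_box n p" "vec_cong x y (int p)"
  shows "x = y"
  using assms by (intro eq_vecI) (auto simp: residue_box_def vec_cong_def cong_def)

text \<open>Reduced modulo \<open>p\<close>, the affine map is an injective self-map of a finite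
  set: applying the adjugate to \<open>P *\<^sub>v x\<close> gives
  \<open>det P \<cdot>\<^sub>v x\<close>, and \<open>det P\<close> can be cancelled modulo
  \<open>p\<close>.\<close>

lemma sum_residue_box_affine:
  fixes f :: "int vec \<Rightarrow> 'a::comm_monoid_add"
  assumes p: "p > 0" and P: "P \<in> carrier_mat n n" and w: "w \<in> carrier_vec n"
    and cop: "coprime (det P) (int p)"
    and f: "\<And>x y. x \<in> carrier_vec n \<Longrightarrow> y \<in> carrier_vec n \<Longrightarrow> vec_cong x y (int p) \<Longrightarrow> f x = f y"
  shows "(\<Sum>x\<in>residue_box n p. f (P *\<^sub>v x + w)) = sum f (residue_box n p)"
proof -
  let ?B = "residue_box n p"
  let ?h = "\<lambda>x. map_vec (\<lambda>a. a mod int p) (P *\<^sub>v x + w)"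
  have cong: "vec_cong (P *\<^sub>v x + w) (?h x) (int p)" for x
    using P w by (auto simp: vec_cong_def cong_def)
  have "inj_on ?h ?B"
  proof (rule inj_onI)
    fix x y assume xy: "x \<in> ?B" "y \<in> ?B" "?h x = ?h y"
    have xy': "x \<in> carrier_vec n" "y \<in> carrier_vec n" using xy by (auto simp: residue_box_def)
    have "vec_cong (P *\<^sub>v x + w) (P *\<^sub>v y + w) (int p)"
      using cong[of x] cong[of y] xy(3) by (metis vec_cong_sym vec_cong_trans)
    then have "vec_cong (P *\<^sub>v x) (P *\<^sub>v y) (int p)"
      using P w xy' by (auto simp: vec_cong_def cong_add_rcancel simp del: index_mult_mat_vec)
    then have "vec_cong (adj_mat P *\<^sub>v (P *\<^sub>v x)) (adj_mat P *\<^sub>v (P *\<^sub>v y)) (int p)"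
      by (rule mult_mat_vec_cong) (use P adj_mat(1)[OF P] in auto)
    moreover have "adj_mat P *\<^sub>v (P *\<^sub>v z) = det P \<cdot>\<^sub>v z" if "z \<in> carrier_vec n" for z
    proof -
      have "adj_mat P *\<^sub>v (P *\<^sub>v z) = (adj_mat P * P) *\<^sub>v z"
        by (rule assoc_mult_mat_vec[symmetric, OF adj_mat(1)[OF P] P that])
      also have "\<dots> = det P \<cdot>\<^sub>v z"
        unfolding adj_mat(3)[OF P] using that by (intro eq_vecI) auto
      finally show ?thesis .
    qed
    ultimately have "vec_cong (det P \<cdot>\<^sub>v x) (det P \<cdot>\<^sub>v y) (int p)" using xy' by simp
    then have "vec_cong x y (int p)"
      using xy' cop by (auto simp: vec_cong_def cong_mult_lcancel)
    then show "x = y" using xy residue_box_eq_if_cong by blast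
  qed
  moreover have "?h ` ?B \<subseteq> ?B" using p P w by (auto simp: residue_box_def)
  ultimately have bij: "bij_betw ?h ?B ?B"
    by (simp add: bij_betw_def endo_inj_surj finite_residue_box)
  have "(\<Sum>x\<in>?B. f (P *\<^sub>v x + w)) = (\<Sum>x\<in>?B. f (?h x))"
    by (rule sum.cong[OF refl], rule f[OF _ _ cong]) (use P w in \<open>auto dest: residue_box_carrier\<close>)
  also have "\<dots> = sum f ?B" by (rule sum.reindex_bij_betw[OF bij])
  finally show ?thesis .
qed

lemma mult_mat_vec_smult:
  fixes A :: "'a::comm_ring_1 mat"
  assumes "A \<in> carrier_mat nr nc" "v \<in> carrier_vec nc"
  shows "A *\<^sub>v (k \<cdot>\<^sub>v v) = k \<cdot>\<^sub>v (A *\<^sub>v v)"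
  using assms by (intro eq_vecI) (auto simp: scalar_prod_smult_distrib[of _ nc])

section \<open>Even symmetric matrices and their half forms\<close>

text \<open>Bundles symmetry with the even diagonal required by \<open>even_integral\<close>;
  together they make every value of the quadratic form even, so that the division in
  \<open>half_form\<close> is exact.\<close>

definition even_symmetric :: "nat \<Rightarrow> int mat \<Rightarrow> bool" where
  "even_symmetric n G \<longleftrightarrow> G \<in> carrier_mat n n \<and> transpose_mat G = G \<and> (\<forall>i<n. even (G $$ (i, i)))"

lemma even_symmetricD:
  assumes "even_symmetric n G"
  shows "G \<in> carrier_mat n n" "transpose_mat G = G"
    "\<And>i. i < n \<Longrightarrow> even (G $$ (i, i))" "\<And>i j. i < n \<Longrightarrow> j < n \<Longrightarrow> G $$ (i, j) = G $$ (j, i)"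
proof -
  show G: "G \<in> carrier_mat n n" "transpose_mat G = G" "\<And>i. i < n \<Longrightarrow> even (G $$ (i, i))"
    using assms by (auto simp: even_symmetric_def)
  show "G $$ (i, j) = G $$ (j, i)" if "i < n" "j < n" for i j
    using that G(1) arg_cong[OF G(2), of "\<lambda>M. M $$ (i, j)"] by simp
qed

lemma symmetric_bilinear:
  fixes G :: "int mat"
  assumes "G \<in> carrier_mat n n" "transpose_mat G = G" "x \<in> carrier_vec n" "y \<in> carrier_vec n"
  shows "x \<bullet> (G *\<^sub>v y) = y \<bullet> (G *\<^sub>v x)"
proof -
  have "x \<bullet> (G *\<^sub>v y) = (transpose_mat G *\<^sub>v x) \<bullet> y"
    using transpose_vec_mult_scalar[OF assms(1,4,3)] assms
    by (subst comm_scalar_prod[of _ n]) (auto intro: comm_scalar_prod[of _ n])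
  also have "\<dots> = y \<bullet> (G *\<^sub>v x)"
    unfolding assms(2) by (rule comm_scalar_prod[of _ n]) (use assms in auto)
  finally show ?thesis .
qed

lemma quadratic_add:
  fixes G :: "int mat"
  assumes "G \<in> carrier_mat n n" "transpose_mat G = G" "x \<in> carrier_vec n" "y \<in> carrier_vec n"
  shows "(x + y) \<bullet> (G *\<^sub>v (x + y)) = x \<bullet> (G *\<^sub>v x) + y \<bullet> (G *\<^sub>v y) + 2 * (x \<bullet> (G *\<^sub>v y))"
proof -
  have "(x + y) \<bullet> (G *\<^sub>v (x + y)) =
    x \<bullet> (G *\<^sub>v x) + x \<bullet> (G *\<^sub>v y) + (y \<bullet> (G *\<^sub>v x) + y \<bullet> (G *\<^sub>v y))"
    using assms by (simp add: mult_add_distrib_mat_vec add_scalar_prod_distrib[of _ n]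
      scalar_prod_add_distrib[of _ n])
  then show ?thesis using symmetric_bilinear[OF assms] by simp
qed

lemma quadratic_double_sum:
  fixes G :: "int mat"
  assumes "G \<in> carrier_mat n n" "x \<in> carrier_vec n"
  shows "x \<bullet> (G *\<^sub>v x) = (\<Sum>i<n. \<Sum>j<n. x $ i * G $$ (i, j) * x $ j)"
proof -
  have "x \<bullet> (G *\<^sub>v x) = (\<Sum>i<n. x $ i * (\<Sum>j<n. G $$ (i, j) * x $ j))"
    using assms by (auto simp: scalar_prod_def lessThan_atLeast0 intro!: sum.cong)
  then show ?thesis by (simp add: sum_distrib_left mult.assoc)
qed

text \<open>Off-diagonal terms come in equal pairs; in the induction the new last row and last
  column cancel modulo 2.\<close>

lemma even_double_sum_symmetric:
  fixes a :: "nat \<Rightarrow> nat \<Rightarrow> int"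
  assumes "\<And>i j. i < n \<Longrightarrow> j < n \<Longrightarrow> a i j = a j i" "\<And>i. i < n \<Longrightarrow> even (a i i)"
  shows "even (\<Sum>i<n. \<Sum>j<n. a i j)"
  using assms
proof (induction n)
  case (Suc n)
  have "(\<Sum>i<Suc n. \<Sum>j<Suc n. a i j) =
      (\<Sum>i<n. \<Sum>j<n. a i j) + (\<Sum>i<n. a i n) + (\<Sum>j<n. a n j) + a n n"
    by (simp add: sum.distrib)
  moreover have "(\<Sum>j<n. a n j) = (\<Sum>i<n. a i n)"
    using Suc.prems(1) by (intro sum.cong) auto
  moreover have "even (\<Sum>i<n. \<Sum>j<n. a i j)" using Suc by auto
  ultimately show ?case using Suc.prems(2) by simp
qed simp

lemma even_quadratic:
  assumes "even_symmetric n G" "x \<in> carrier_vec n"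
  shows "even (x \<bullet> (G *\<^sub>v x))"
  unfolding quadratic_double_sum[OF even_symmetricD(1)[OF assms(1)] assms(2)]
  by (rule even_double_sum_symmetric)
     (auto simp: even_symmetricD(3)[OF assms(1)] even_symmetricD(4)[OF assms(1)])

lemma two_half_form:
  assumes "even_symmetric n G" "x \<in> carrier_vec n"
  shows "2 * half_form G x = x \<bullet> (G *\<^sub>v x)"
  using even_quadratic[OF assms] by (simp add: half_form_def)

lemma half_form_add:
  assumes "even_symmetric n G" "x \<in> carrier_vec n" "y \<in> carrier_vec n"
  shows "half_form G (x + y) = half_form G x + half_form G y + x \<bullet> (G *\<^sub>v y)"
proof -
  have "2 * half_form G (x + y) = 2 * (half_form G x + half_form G y + x \<bullet> (G *\<^sub>v y))"
    using assms quadratic_add[OF even_symmetricD(1,2)[OF assms(1)] assms(2,3)]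
    by (simp add: two_half_form[of n] distrib_left)
  then show ?thesis by simp
qed

text \<open>Writing x = y + m z, the half forms differ by m times an integer. This gives the
  congruence modulo \<open>m\<close> itself also for even \<open>m\<close>, where a congruence
  between the full quadratic forms could not simply be halved.\<close>

lemma half_form_cong:
  assumes "even_symmetric n G" "x \<in> carrier_vec n" "y \<in> carrier_vec n" "vec_cong x y m"
  shows "[half_form G x = half_form G y] (mod m)"
proof -
  note G = even_symmetricD[OF assms(1)]
  define z where "z = vec n (\<lambda>i. (x $ i - y $ i) div m)"
  have z: "z \<in> carrier_vec n" by (simp add: z_def)
  have "x = y + m \<cdot>\<^sub>v z"
    using assms(2-4) by (intro eq_vecI) (auto simp: z_def vec_cong_def cong_iff_dvd_diff)
  moreover have "half_form G (m \<cdot>\<^sub>v z) = m * (m * half_form G z)"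
  proof -
    have "2 * half_form G (m \<cdot>\<^sub>v z) = 2 * (m * (m * half_form G z))"
      using two_half_form[OF assms(1), of "m \<cdot>\<^sub>v z"] two_half_form[OF assms(1) z] z G(1)
      by (simp add: mult_mat_vec_smult[of _ n n] scalar_prod_smult_distrib[of _ n] smult_scalar_prod_distrib[of _ n])
    then show ?thesis by simp
  qed
  moreover have "y \<bullet> (G *\<^sub>v (m \<cdot>\<^sub>v z)) = m * (y \<bullet> (G *\<^sub>v z))"
    using z G(1) assms(3) by (simp add: mult_mat_vec_smult[of _ n n] scalar_prod_smult_distrib[of _ n])
  ultimately have "half_form G x = half_form G y + m * (m * half_form G z + y \<bullet> (G *\<^sub>v z))"
    using half_form_add[OF assms(1,3), of "m \<cdot>\<^sub>v z"] z by (simp add: algebra_simps)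
  then show ?thesis by (simp add: cong_iff_dvd_diff)
qed

lemma quadratic_congruence:
  fixes G :: "int mat"
  assumes "G \<in> carrier_mat n n" "P \<in> carrier_mat n n" "x \<in> carrier_vec n" "y \<in> carrier_vec n"
  shows "x \<bullet> ((transpose_mat P * G * P) *\<^sub>v y) = (P *\<^sub>v x) \<bullet> (G *\<^sub>v (P *\<^sub>v y))"
proof -
  have "(transpose_mat P * G * P) *\<^sub>v y = transpose_mat P *\<^sub>v (G *\<^sub>v (P *\<^sub>v y))"
    using assms by (simp add: assoc_mult_mat_vec[of _ n n _ n])
  also have "x \<bullet> \<dots> = (G *\<^sub>v (P *\<^sub>v y)) \<bullet> (P *\<^sub>v x)"
    using assms by (subst comm_scalar_prod[of _ n]) (auto simp: transpose_vec_mult_scalar[of _ n n])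
  also have "\<dots> = (P *\<^sub>v x) \<bullet> (G *\<^sub>v (P *\<^sub>v y))"
    using assms by (subst comm_scalar_prod[of _ n]) auto
  finally show ?thesis .
qed

lemma mat_entry_eq_bilinear:
  fixes M :: "int mat"
  assumes "M \<in> carrier_mat n n" "i < n" "j < n"
  shows "M $$ (i, j) = unit_vec n i \<bullet> (M *\<^sub>v unit_vec n j)"
  using assms by simp

text \<open>The diagonal entries of the transformed matrix are the values of the quadratic form of
  \<open>G\<close> at the columns of \<open>P\<close>.\<close>

lemma even_symmetric_congruence:
  assumes "even_symmetric n G" "P \<in> carrier_mat n n"
  shows "even_symmetric n (transpose_mat P * G * P)"
proof -
  note G = even_symmetricD[OF assms(1)]
  let ?M = "transpose_mat P * G * P"
  have M: "?M \<in> carrier_mat n n" using G assms(2) by auto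
  have "transpose_mat ?M = transpose_mat P * (transpose_mat G * P)"
    using G(1) assms(2) by (simp add: transpose_mult[of _ n n _ n])
  also have "\<dots> = ?M" unfolding G(2) using G(1) assms(2) by (simp add: assoc_mult_mat[of _ n n _ n _ n])
  finally have "transpose_mat ?M = ?M" .
  moreover have "even (?M $$ (i, i))" if "i < n" for i
    unfolding mat_entry_eq_bilinear[OF M that that]
    using quadratic_congruence[OF G(1) assms(2), of "unit_vec n i" "unit_vec n i"]
      even_quadratic[OF assms(1), of "P *\<^sub>v unit_vec n i"] assms(2) by simp
  ultimately show ?thesis using M by (simp add: even_symmetric_def)
qed

lemma half_form_congruence:
  assumes "even_symmetric n G" "P \<in> carrier_mat n n" "x \<in> carrier_vec n"
  shows "half_form (transpose_mat P * G * P) x = half_form G (P *\<^sub>v x)"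
  using quadratic_congruence[OF even_symmetricD(1)[OF assms(1)] assms(2,3,3)]
  by (simp add: half_form_def)

lemma half_form_block_diag:
  assumes "even_symmetric r A" "even_symmetric s C" "x \<in> carrier_vec r" "y \<in> carrier_vec s"
  shows "half_form (four_block_mat A (0\<^sub>m r s) (0\<^sub>m s r) C) (x @\<^sub>v y) = half_form A x + half_form C y"
proof -
  note A = even_symmetricD(1)[OF assms(1)] and C = even_symmetricD(1)[OF assms(2)]
  have "four_block_mat A (0\<^sub>m r s) (0\<^sub>m s r) C *\<^sub>v (x @\<^sub>v y) = (A *\<^sub>v x) @\<^sub>v (C *\<^sub>v y)"
    using A C assms by (subst four_block_mat_mult_vec[of _ r r _ s _ s]) auto
  then have "(x @\<^sub>v y) \<bullet> (four_block_mat A (0\<^sub>m r s) (0\<^sub>m s r) C *\<^sub>v (x @\<^sub>v y)) =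
      x \<bullet> (A *\<^sub>v x) + y \<bullet> (C *\<^sub>v y)"
    using A C assms by (simp add: scalar_prod_append[of _ r _ s])
  then show ?thesis
    using even_quadratic[OF assms(1,3)] even_quadratic[OF assms(2,4)] by (simp add: half_form_def)
qed

section \<open>Gauss sums of quadratic forms\<close>

definition quadratic_gauss_sum :: "nat \<Rightarrow> nat \<Rightarrow> int \<Rightarrow> int mat \<Rightarrow> complex" where
  "quadratic_gauss_sum n p t G = (\<Sum>x\<in>residue_box n p. add_char p (t * half_form G x))"

lemma quadratic_gauss_sum_congruence:
  assumes "p > 0" "even_symmetric n G" "P \<in> carrier_mat n n" "coprime (det P) (int p)"
  shows "quadratic_gauss_sum n p t (transpose_mat P * G * P) = quadratic_gauss_sum n p t G"
proof -
  have "quadratic_gauss_sum n p t (transpose_mat P * G * P) =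
      (\<Sum>x\<in>residue_box n p. add_char p (t * half_form G (P *\<^sub>v x + 0\<^sub>v n)))"
    unfolding quadratic_gauss_sum_def
    using assms by (intro sum.cong refl) (auto simp: half_form_congruence dest: residue_box_carrier)
  also have "\<dots> = quadratic_gauss_sum n p t G"
    unfolding quadratic_gauss_sum_def
    by (rule sum_residue_box_affine[OF assms(1,3) _ assms(4)])
       (auto intro!: add_char_cong assms(1) cong_scalar_left half_form_cong[OF assms(2)])
  finally show ?thesis .
qed

lemma quadratic_gauss_sum_block_diag:
  assumes "even_symmetric r A" "even_symmetric s C"
  shows "quadratic_gauss_sum (r + s) p t (four_block_mat A (0\<^sub>m r s) (0\<^sub>m s r) C) =
    quadratic_gauss_sum r p t A * quadratic_gauss_sum s p t C"
  unfolding quadratic_gauss_sum_def sum_residue_box_append sum_product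
  by (intro sum.cong refl)
     (simp add: half_form_block_diag[OF assms residue_box_carrier residue_box_carrier]
       distrib_left add_char_add)

section \<open>Splitting off a leading block\<close>

text \<open>\<open>P\<close> is block upper triangular with diagonal blocks d times the identity,
  hence \<open>det P = d ^ (r + s)\<close>. The leading block becomes d^2 times the old one, whose
  determinant is d; this accounts for the exponent \<open>2 * r + 1\<close>.\<close>

lemma block_elimination:
  assumes "even_symmetric (r + s) G"
  defines "d \<equiv> det (mat r r (\<lambda>(i, j). G $$ (i, j)))"
  obtains P A C where "P \<in> carrier_mat (r + s) (r + s)" "det P = d ^ (r + s)"
    "even_symmetric r A" "even_symmetric s C" "det A = d ^ (2 * r + 1)"
    "transpose_mat P * G * P = four_block_mat A (0\<^sub>m r s) (0\<^sub>m s r) C"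
proof -
  note G = even_symmetricD[OF assms(1)]
  obtain A B B' C0 where split: "split_block G r r = (A, B, B', C0)" by (metis prod_cases4)
  have dims: "dim_row G = r + s" "dim_col G = r + s" using G(1) by auto
  note car = split_block(1-4)[OF split dims] and G_eq = split_block(5)[OF split dims]
  have A_def: "A = mat r r (\<lambda>(i, j). G $$ (i, j))"
    using split by (simp add: split_block_def Let_def)
  have det_A: "det A = d" by (simp add: A_def d_def)
  note adj = adj_mat[OF car(1), unfolded det_A]
  \<comment> \<open>The block completion of the square uses \<open>- A\<inverse> B\<close>; scaling by \<open>d\<close> keeps it integral.\<close>
  define P where "P = four_block_mat (d \<cdot>\<^sub>m 1\<^sub>m r) (- (adj_mat A * B)) (0\<^sub>m s r) (d \<cdot>\<^sub>m 1\<^sub>m s)"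
  have P: "P \<in> carrier_mat (r + s) (r + s)" unfolding P_def by simp
  have det_P: "det P = d ^ (r + s)"
    unfolding P_def using adj car
    by (subst det_four_block_mat_lower_left_zero[of _ r _ s]) (auto simp: det_smult power_add)
  let ?M = "transpose_mat P * G * P"
  have M: "even_symmetric (r + s) ?M" by (rule even_symmetric_congruence[OF assms(1) P])
  have "A * - (adj_mat A * B) + B * (d \<cdot>\<^sub>m 1\<^sub>m s) = - (A * adj_mat A * B) + d \<cdot>\<^sub>m B"
    using car adj(1) by (simp add: assoc_mult_mat[of A r r _ r _ s] mult_smult_distrib[of B r s _ s])
  also have "A * adj_mat A * B = d \<cdot>\<^sub>m B"
    unfolding adj(2) using car by (simp add: mult_smult_assoc_mat[of _ r r B s])
  also have "- (d \<cdot>\<^sub>m B) + d \<cdot>\<^sub>m B = 0\<^sub>m r s" using car by auto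
  finally have X12: "A * - (adj_mat A * B) + B * (d \<cdot>\<^sub>m 1\<^sub>m s) = 0\<^sub>m r s" .
  define Y Z where "Y = B' * (d \<cdot>\<^sub>m 1\<^sub>m r) + C0 * 0\<^sub>m s r"
    and "Z = B' * - (adj_mat A * B) + C0 * (d \<cdot>\<^sub>m 1\<^sub>m s)"
  have YZ: "Y \<in> carrier_mat s r" "Z \<in> carrier_mat s s"
    using car adj(1) unfolding Y_def Z_def carrier_mat_def by simp_all
  have "G * P = four_block_mat (A * (d \<cdot>\<^sub>m 1\<^sub>m r) + B * 0\<^sub>m s r)
      (A * - (adj_mat A * B) + B * (d \<cdot>\<^sub>m 1\<^sub>m s)) Y Z"
    unfolding P_def Y_def Z_def by (subst G_eq, rule mult_four_block_mat[of _ r r _ s _ s _ _ r _ s]) (use car adj(1) in auto)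
  also have "A * (d \<cdot>\<^sub>m 1\<^sub>m r) + B * 0\<^sub>m s r = d \<cdot>\<^sub>m A"
    using car by (simp add: mult_smult_distrib[of A r r _ r])
  finally have GP: "G * P = four_block_mat (d \<cdot>\<^sub>m A) (0\<^sub>m r s) Y Z" unfolding X12 .
  have PT: "transpose_mat P =
      four_block_mat (d \<cdot>\<^sub>m 1\<^sub>m r) (0\<^sub>m r s) (transpose_mat (- (adj_mat A * B))) (d \<cdot>\<^sub>m 1\<^sub>m s)"
  proof -
    have "transpose_mat (d \<cdot>\<^sub>m 1\<^sub>m m) = d \<cdot>\<^sub>m 1\<^sub>m m" for m by (intro eq_matI) auto
    moreover have "- (adj_mat A * B) \<in> carrier_mat r s" using car adj(1) by auto
    ultimately show ?thesis
      unfolding P_def by (subst transpose_four_block_mat[of _ r r _ s _ s]) simp_all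
  qed
  let ?Q = "transpose_mat (- (adj_mat A * B))"
  have Q: "?Q \<in> carrier_mat s r" using car adj(1) by auto
  define Y' C where "Y' = ?Q * (d \<cdot>\<^sub>m A) + d \<cdot>\<^sub>m 1\<^sub>m s * Y"
    and "C = ?Q * 0\<^sub>m r s + d \<cdot>\<^sub>m 1\<^sub>m s * Z"
  have C: "C \<in> carrier_mat s s" "Y' \<in> carrier_mat s r"
    using car YZ Q unfolding C_def Y'_def carrier_mat_def by simp_all
  have "?M = transpose_mat P * (G * P)"
    by (rule assoc_mult_mat) (use P G(1) in auto)
  also have "\<dots> = four_block_mat (d \<cdot>\<^sub>m 1\<^sub>m r * (d \<cdot>\<^sub>m A) + 0\<^sub>m r s * Y)
      (d \<cdot>\<^sub>m 1\<^sub>m r * 0\<^sub>m r s + 0\<^sub>m r s * Z) Y' C"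
    unfolding PT GP Y'_def C_def 
    by (rule mult_four_block_mat[of _ r r _ s _ s _ _ r _ s]) (use car YZ Q in simp_all)
  also have "d \<cdot>\<^sub>m 1\<^sub>m r * (d \<cdot>\<^sub>m A) + 0\<^sub>m r s * Y = d \<cdot>\<^sub>m (d \<cdot>\<^sub>m A)"
    using car YZ by (simp add: mult_smult_assoc_mat[of _ r r _ r])
  also have "d \<cdot>\<^sub>m 1\<^sub>m r * 0\<^sub>m r s + 0\<^sub>m r s * Z = 0\<^sub>m r s"
    using YZ by simp
  finally have M_block: "?M = four_block_mat (d \<cdot>\<^sub>m (d \<cdot>\<^sub>m A)) (0\<^sub>m r s) Y' C" .
  have entry: "?M $$ (i, j) = (if i < r then if j < r then (d \<cdot>\<^sub>m (d \<cdot>\<^sub>m A)) $$ (i, j) else 0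
      else if j < r then Y' $$ (i - r, j) else C $$ (i - r, j - r))"
    if "i < r + s" "j < r + s" for i j
    unfolding M_block using that car C(1,2) by auto
  \<comment> \<open>The lower left block need not be computed: the transformed matrix is symmetric
    and its upper right block is zero.\<close>
  have "Y' $$ (i, j) = 0" if "i < s" "j < r" for i j
    using entry[of "r + i" j] entry[of j "r + i"] even_symmetricD(4)[OF M, of j "r + i"] that by simp
  then have "Y' = 0\<^sub>m s r" using C(2) by (intro eq_matI) auto
  note M_eq = M_block[unfolded this]
  have "even_symmetric r (d \<cdot>\<^sub>m (d \<cdot>\<^sub>m A))"
    unfolding even_symmetric_def
  proof (intro conjI allI impI)
    show "transpose_mat (d \<cdot>\<^sub>m (d \<cdot>\<^sub>m A)) = d \<cdot>\<^sub>m (d \<cdot>\<^sub>m A)"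
      using car G(4) by (intro eq_matI) (auto simp: A_def)
    show "even ((d \<cdot>\<^sub>m (d \<cdot>\<^sub>m A)) $$ (i, i))" if "i < r" for i
      using entry[of i i] even_symmetricD(3)[OF M, of i] that by simp
  qed (use car in auto)
  moreover have "even_symmetric s C"
    unfolding even_symmetric_def
  proof (intro conjI allI impI)
    have "C $$ (j, i) = C $$ (i, j)" if "i < s" "j < s" for i j
      using entry[of "r + i" "r + j"] entry[of "r + j" "r + i"]
        even_symmetricD(4)[OF M, of "r + i" "r + j"] that by simp
    then show "transpose_mat C = C" using C(1) by (intro eq_matI) auto
    show "even (C $$ (i, i))" if "i < s" for i
      using entry[of "r + i" "r + i"] even_symmetricD(3)[OF M, of "r + i"] that by simp
  qed (rule C(1))
  moreover have "det (d \<cdot>\<^sub>m (d \<cdot>\<^sub>m A)) = d ^ (2 * r + 1)"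
    using car by (simp add: det_smult det_A mult_2 power_add)
  ultimately show thesis using that P det_P M_eq by blast
qed

section \<open>Unimodular changes of basis that produce a pivot\<close>

lemma exists_unit_in_row:
  fixes G :: "int mat"
  assumes "G \<in> carrier_mat n n" "i < n" "\<not> q dvd det G"
  shows "\<exists>j<n. \<not> q dvd G $$ (i, j)"
proof (rule ccontr)
  assume "\<not> (\<exists>j<n. \<not> q dvd G $$ (i, j))"
  then have "q dvd (\<Sum>j<n. G $$ (i, j) * cofactor G i j)"
    by (intro dvd_sum dvd_mult2) auto
  then show False using laplace_expansion_row[OF assms(1,2)] assms(3) by simp
qed

lemma addrow_mat_mult_unit_vec:
  fixes a :: int
  assumes "k < n" "l < n" "j < n" "k \<noteq> l"
  shows "addrow_mat n a k l *\<^sub>v unit_vec n j =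
    (if j = l then unit_vec n l + a \<cdot>\<^sub>v unit_vec n k else unit_vec n j)"
  using assms by (intro eq_vecI) auto

text \<open>If \<open>p\<close> divides the corner entry, choose j with \<open>G $$ (0, j)\<close>
  prime to \<open>p\<close> and replace the basis vector e_0 by e_0 + a e_j with a = 1 or a = -1. If
  both choices failed, \<open>p\<close> would divide the difference
  \<open>4 * G $$ (0, j)\<close>.\<close>

lemma exists_pivot_odd_prime:
  assumes "prime p" "p > 2" "even_symmetric n G" "n > 0" "\<not> int p dvd det G"
  shows "\<exists>P \<in> carrier_mat n n. det P = 1 \<and> \<not> int p dvd (transpose_mat P * G * P) $$ (0, 0)"
proof (cases "int p dvd G $$ (0, 0)")
  case False
  then show ?thesis using even_symmetricD(1)[OF assms(3)] by (intro bexI[of _ "1\<^sub>m n"]) auto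
next
  case True
  note G = even_symmetricD[OF assms(3)]
  obtain j where j: "j < n" "\<not> int p dvd G $$ (0, j)"
    using exists_unit_in_row[OF G(1) assms(4,5)] by blast
  then have j0: "j \<noteq> 0" using True by metis
  let ?P = "\<lambda>a. addrow_mat n a j 0"
  have entry: "(transpose_mat (?P a) * G * ?P a) $$ (0, 0) = G $$ (0, 0) + a * a * G $$ (j, j) + 2 * a * G $$ (0, j)" for a
  proof -
    have M: "transpose_mat (?P a) * G * ?P a \<in> carrier_mat n n" using G(1) by auto
    have "(transpose_mat (?P a) * G * ?P a) $$ (0, 0) =
        (unit_vec n 0 + a \<cdot>\<^sub>v unit_vec n j) \<bullet> (G *\<^sub>v (unit_vec n 0 + a \<cdot>\<^sub>v unit_vec n j))"
      unfolding mat_entry_eq_bilinear[OF M assms(4,4)]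
        quadratic_congruence[OF G(1) addrow_mat_carrier unit_vec_carrier unit_vec_carrier]
        addrow_mat_mult_unit_vec[OF j(1) assms(4,4) j0] by (simp only: simp_thms if_True)
    also have "\<dots> = G $$ (0, 0) + a * a * G $$ (j, j) + 2 * a * G $$ (0, j)"
    proof -
      have pull: "G *\<^sub>v (a \<cdot>\<^sub>v unit_vec n j) = a \<cdot>\<^sub>v (G *\<^sub>v unit_vec n j)"
        by (rule mult_mat_vec_smult[OF G(1)]) simp
      have car: "G *\<^sub>v unit_vec n j \<in> carrier_vec n" using G(1) by simp
      have 1: "unit_vec n 0 \<bullet> (G *\<^sub>v (a \<cdot>\<^sub>v unit_vec n j)) = a * G $$ (0, j)"
        unfolding pull mat_entry_eq_bilinear[OF G(1) assms(4) j(1)]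
        by (rule scalar_prod_smult_distrib[OF unit_vec_carrier car])
      have "(a \<cdot>\<^sub>v unit_vec n j) \<bullet> (a \<cdot>\<^sub>v (G *\<^sub>v unit_vec n j)) =
          a * (a * (unit_vec n j \<bullet> (G *\<^sub>v unit_vec n j)))"
        unfolding smult_scalar_prod_distrib[OF unit_vec_carrier smult_carrier_vec[THEN iffD2, OF car]]
        unfolding scalar_prod_smult_distrib[OF unit_vec_carrier car] ..
      then have 2: "(a \<cdot>\<^sub>v unit_vec n j) \<bullet> (G *\<^sub>v (a \<cdot>\<^sub>v unit_vec n j)) = a * a * G $$ (j, j)"
        unfolding pull mat_entry_eq_bilinear[OF G(1) j(1,1)] by (simp only: mult.assoc)
      have "(unit_vec n 0 + a \<cdot>\<^sub>v unit_vec n j) \<bullet> (G *\<^sub>v (unit_vec n 0 + a \<cdot>\<^sub>v unit_vec n j)) =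
          unit_vec n 0 \<bullet> (G *\<^sub>v unit_vec n 0) +
          (a \<cdot>\<^sub>v unit_vec n j) \<bullet> (G *\<^sub>v (a \<cdot>\<^sub>v unit_vec n j)) +
          2 * (unit_vec n 0 \<bullet> (G *\<^sub>v (a \<cdot>\<^sub>v unit_vec n j)))"
        by (rule quadratic_add[OF G(1,2)]) simp_all
      then show ?thesis
        unfolding 1 2 mat_entry_eq_bilinear[OF G(1) assms(4,4), symmetric] by (simp only: mult.assoc)
    qed
    finally show ?thesis .
  qed
  have "\<not> (int p dvd G $$ (j, j) + 2 * G $$ (0, j) \<and> int p dvd G $$ (j, j) - 2 * G $$ (0, j))"
  proof
    assume "int p dvd G $$ (j, j) + 2 * G $$ (0, j) \<and> int p dvd G $$ (j, j) - 2 * G $$ (0, j)"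
    then have "int p dvd (G $$ (j, j) + 2 * G $$ (0, j)) - (G $$ (j, j) - 2 * G $$ (0, j))"
      by (blast intro: dvd_diff)
    then have "int p dvd 2 * (2 * G $$ (0, j))" by simp
    moreover have "\<not> int p dvd 2" using assms(2) by (auto dest: zdvd_imp_le)
    moreover have "prime (int p)" using assms(1) by simp
    ultimately show False using j(2) prime_dvd_mult_iff by blast
  qed
  then have "\<exists>a. a * a = 1 \<and> \<not> int p dvd G $$ (j, j) + 2 * a * G $$ (0, j)"
    by (cases "int p dvd G $$ (j, j) + 2 * G $$ (0, j)") (auto intro: exI[of _ 1] exI[of _ "- 1"])
  then obtain a where a: "a * a = 1" "\<not> int p dvd G $$ (j, j) + 2 * a * G $$ (0, j)" by blast
  have "\<not> int p dvd (transpose_mat (?P a) * G * ?P a) $$ (0, 0)"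
    unfolding entry a(1) add.assoc dvd_add_right_iff[OF True] using a(2) by simp
  then show ?thesis using det_addrow_mat[OF j0] addrow_mat_carrier by blast
qed

text \<open>Diagonal entries are even, so a block of size 1 can never serve as pivot, and the odd
  entry of row 0 lies off the diagonal, which forces \<open>n \<ge> 2\<close>. If it is not yet in
  column 1, adding e_j to e_1 brings it there. An odd entry at (0, 1) makes the leading minor of
  size 2 an even number minus an odd square.\<close>

lemma exists_pivot_two:
  assumes "even_symmetric n G" "n > 0" "odd (det G)"
  shows "n \<ge> 2 \<and> (\<exists>P \<in> carrier_mat n n. det P = 1 \<and> odd ((transpose_mat P * G * P) $$ (0, 1)))"
proof -
  note G = even_symmetricD[OF assms(1)]
  obtain j where j: "j < n" "odd (G $$ (0, j))"
    using exists_unit_in_row[OF G(1) assms(2,3)] by blast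
  then have j0: "j \<noteq> 0" using G(3) assms(2) by metis
  then have n: "n \<ge> 2" using j(1) by linarith
  show ?thesis
  proof (cases "odd (G $$ (0, 1))")
    case True
    then show ?thesis using n G(1) by (intro conjI bexI[of _ "1\<^sub>m n"]) auto
  next
    case False
    then have j1: "j \<noteq> 1" using j(2) by metis
    let ?P = "addrow_mat n (1::int) j 1"
    have M: "transpose_mat ?P * G * ?P \<in> carrier_mat n n" using G(1) by auto
    have "(transpose_mat ?P * G * ?P) $$ (0, 1) =
        unit_vec n 0 \<bullet> (G *\<^sub>v (unit_vec n 1 + unit_vec n j))"
      using mat_entry_eq_bilinear[OF M, of 0 1]
        quadratic_congruence[OF G(1), of "?P" "unit_vec n 0" "unit_vec n 1"] j j1 n
      by (simp add: addrow_mat_mult_unit_vec)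
    also have "\<dots> = G $$ (0, 1) + G $$ (0, j)"
    proof -
      have "G *\<^sub>v (unit_vec n 1 + unit_vec n j) = G *\<^sub>v unit_vec n 1 + G *\<^sub>v unit_vec n j"
        by (rule mult_add_distrib_mat_vec[OF G(1)]) simp_all
      moreover have "0 < n" "1 < n" using n by simp_all
      ultimately show ?thesis
        using G(1) j(1) by (simp only: mat_entry_eq_bilinear[OF G(1)])
          (rule scalar_prod_add_distrib[of _ n], simp_all)
    qed
    finally have "odd ((transpose_mat ?P * G * ?P) $$ (0, 1))" using False j(2) by simp
    then show ?thesis using n det_addrow_mat[OF j1] addrow_mat_carrier by blast
  qed
qed

lemma det_mat_2:
  "det (mat 2 2 f) = f (0, 0) * f (1, 1) - f (0, 1) * (f (1, 0) :: int)"
proof -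
  have M: "mat 2 2 f \<in> carrier_mat 2 2" by simp
  have "det (mat 2 2 f) = (\<Sum>j<2. mat 2 2 f $$ (0, j) * cofactor (mat 2 2 f) 0 j)"
    by (rule laplace_expansion_row[OF M]) simp
  then show ?thesis
    by (simp add: numeral_2_eq_2 cofactor_def mat_delete_def det_single)
qed

text \<open>The common induction step for all primes. The multiplier \<open>u\<close> comes from
  clearing denominators; being a unit modulo \<open>p\<close> and entering only as a square, it does
  not affect the quadratic symbols of the determinants.\<close>

lemma split_leading_block:
  assumes "prime p" "even_symmetric n G" "n > 0" "\<not> int p dvd det G"
  defines "r \<equiv> if p = 2 then 2 else 1"
  obtains s u A C where "n = r + s" "even_symmetric r A" "even_symmetric s C"
    "\<not> int p dvd u" "\<not> int p dvd det A" "\<not> int p dvd det C" "u\<^sup>2 * det G = det A * det C"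
    "quadratic_gauss_sum n p t G = quadratic_gauss_sum r p t A * quadratic_gauss_sum s p t C"
proof -
  note G = even_symmetricD[OF assms(2)]
  have p: "prime (int p)" "p > 0" using assms(1) prime_gt_0_nat by auto
  have "\<exists>P s. P \<in> carrier_mat n n \<and> det P = 1 \<and> n = r + s \<and>
      \<not> int p dvd det (mat r r (\<lambda>(i, j). (transpose_mat P * G * P) $$ (i, j)))"
  proof (cases "p = 2")
    case True
    then have "odd (det G)" using assms(4) by simp
    from exists_pivot_two[OF assms(2,3) this] obtain P where
      P: "n \<ge> 2" "P \<in> carrier_mat n n" "det P = 1" "odd ((transpose_mat P * G * P) $$ (0, 1))"
      by blast
    note M = even_symmetricD[OF even_symmetric_congruence[OF assms(2) P(2)]]
    have "odd (det (mat 2 2 (\<lambda>(i, j). (transpose_mat P * G * P) $$ (i, j))))"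
      using P(1,4) M(3)[of 0] M(4)[of 0 1] by (simp add: det_mat_2)
    then show ?thesis using P(1,2,3) True
      by (intro exI[of _ P] exI[of _ "n - 2"]) (simp add: r_def)
  next
    case False
    then have "p > 2" using prime_ge_2_nat[OF assms(1)] by linarith
    from exists_pivot_odd_prime[OF assms(1) this assms(2-4)] show ?thesis
      using False assms(3) by (auto simp: r_def det_single intro!: exI[of _ "n - 1"])
  qed
  then obtain P s where P: "P \<in> carrier_mat n n" "det P = 1" and n: "n = r + s"
    and d: "\<not> int p dvd det (mat r r (\<lambda>(i, j). (transpose_mat P * G * P) $$ (i, j)))" by blast
  let ?M = "transpose_mat P * G * P"
  let ?d = "det (mat r r (\<lambda>(i, j). ?M $$ (i, j)))"
  have M: "even_symmetric n ?M" by (rule even_symmetric_congruence[OF assms(2) P(1)])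
  obtain Q A C where Q: "Q \<in> carrier_mat n n" "det Q = ?d ^ n"
    and AC: "even_symmetric r A" "even_symmetric s C" "det A = ?d ^ (2 * r + 1)"
    and Q_eq: "transpose_mat Q * ?M * Q = four_block_mat A (0\<^sub>m r s) (0\<^sub>m s r) C"
    using block_elimination[OF M[unfolded n]] unfolding n by metis
  have det_congr: "det (transpose_mat R * H * R) = (det R)\<^sup>2 * det H"
    if "R \<in> carrier_mat n n" "H \<in> carrier_mat n n" for R H :: "int mat"
    using that by (simp add: det_mult[of _ n] det_transpose power2_eq_square)
  have u: "\<not> int p dvd ?d ^ n" using d p(1) prime_dvd_power by blast
  have det_A: "\<not> int p dvd det A" unfolding AC(3) using d p(1) prime_dvd_power by blast
  have "(?d ^ n)\<^sup>2 * det G = det (transpose_mat Q * ?M * Q)"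
    using det_congr[OF Q(1) even_symmetricD(1)[OF M]] det_congr[OF P(1) G(1)] P(2) Q(2) by simp
  also have "\<dots> = det A * det C"
    unfolding Q_eq
    using even_symmetricD(1)[OF AC(1)] even_symmetricD(1)[OF AC(2)]
    by (intro det_four_block_mat_lower_left_zero[of _ r _ s]) auto
  finally have det_eq: "(?d ^ n)\<^sup>2 * det G = det A * det C" .
  have "\<not> int p dvd (?d ^ n)\<^sup>2 * det G"
    using u assms(4) prime_dvd_power[OF p(1)] by (auto simp: prime_dvd_mult_iff[OF p(1)])
  then have det_C: "\<not> int p dvd det C" unfolding det_eq by auto
  have "quadratic_gauss_sum n p t G = quadratic_gauss_sum r p t A * quadratic_gauss_sum s p t C"
  proof -
    have "coprime (det Q) (int p)" "coprime (det P) (int p)"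
      unfolding P(2) Q(2) using prime_imp_coprime[OF p(1) u] by (simp_all add: coprime_commute)
    then have "quadratic_gauss_sum n p t G = quadratic_gauss_sum n p t (transpose_mat Q * ?M * Q)"
      using quadratic_gauss_sum_congruence[OF p(2) assms(2) P(1)]
        quadratic_gauss_sum_congruence[OF p(2) M Q(1)] by simp
    then show ?thesis unfolding Q_eq unfolding n quadratic_gauss_sum_block_diag[OF AC(1,2)] .
  qed
  with that n AC(1,2) u det_A det_C det_eq show thesis by blast
qed

section \<open>Evaluation for odd primes\<close>

lemma quadratic_gauss_sum_1:
  assumes "prime p" "p > 2" "even_symmetric 1 A" "\<not> int p dvd det A" "\<not> int p dvd t"
  shows "quadratic_gauss_sum 1 p t A = of_int (Legendre (2 * t * det A) (int p)) * gauss_sum p 1"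
proof -
  note A = even_symmetricD[OF assms(3)]
  obtain a where a: "A $$ (0, 0) = 2 * a" using A(3)[of 0] by auto
  have det_A: "det A = 2 * a" using A(1) a by (simp add: det_single)
  have form: "half_form A (vec 1 (\<lambda>_. x)) = a * x\<^sup>2" for x
  proof -
    have "vec 1 (\<lambda>_. x) \<bullet> (A *\<^sub>v vec 1 (\<lambda>_. x)) = 2 * (a * x\<^sup>2)"
      using A(1) a by (subst quadratic_double_sum) (auto simp: power2_eq_square)
    then show ?thesis by (simp add: half_form_def)
  qed
  have "\<not> int p dvd a" using assms(4) det_A by auto
  then have "\<not> int p dvd t * a" using assms(1,5) by (simp add: prime_dvd_mult_iff)
  then have "quadratic_gauss_sum 1 p t A = of_int (Legendre (t * a) (int p)) * gauss_sum p 1"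
    unfolding quadratic_gauss_sum_def sum_residue_box_1 form
    using sum_add_char_square[OF assms(1,2), of "t * a"] by (simp add: mult.assoc)
  \<comment> \<open>The half form has coefficient a while \<open>det A = 2 * a\<close>; the square
    factor 4 expresses the symbol through the determinant, which is what multiplies along the
    splitting.\<close>
  also have "Legendre (t * a) (int p) = Legendre (2 * 2 * (t * a)) (int p)"
  proof -
    have "\<not> [2 = 0] (mod int p)" using assms(2) by (auto simp: cong_0_iff dest: zdvd_imp_le)
    then show ?thesis
      unfolding Legendre_mult[OF assms(1,2), of "2 * 2"] Legendre_mult[OF assms(1,2), of 2 2]
      by (simp add: Legendre_square)
  qed
  also have "2 * 2 * (t * a) = 2 * t * det A" by (simp add: det_A)
  finally show ?thesis .
qed

lemma quadratic_gauss_sum_odd_prime: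
  assumes "prime p" "p > 2" "\<not> int p dvd t" "even_symmetric n G" "\<not> int p dvd det G"
  shows "quadratic_gauss_sum n p t G =
    of_int (Legendre ((2 * t) ^ n * det G) (int p)) * gauss_sum p 1 ^ n"
  using assms(4,5)
proof (induction n arbitrary: G rule: less_induct)
  case (less n)
  show ?case
  proof (cases "n = 0")
    case True
    have "det G = 1" using even_symmetricD(1)[OF less.prems(1)] True by (simp add: det_dim_zero)
    moreover have "Legendre 1 (int p) = 1"
      using Legendre_power[OF assms(1,2), of 1 0] by simp
    moreover have "half_form G vNil = 0"
      using even_symmetricD(1)[OF less.prems(1)] True by (simp add: half_form_def scalar_prod_def)
    ultimately show ?thesis using True by (simp add: quadratic_gauss_sum_def residue_box_0)
  next
    case False
    have r: "(if p = 2 then 2 else 1) = (1 :: nat)" using assms(2) by simp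
    obtain s u A C where n: "n = 1 + s" and AC: "even_symmetric 1 A" "even_symmetric s C"
      "\<not> int p dvd det A" "\<not> int p dvd det C"
      and u: "\<not> int p dvd u" "u\<^sup>2 * det G = det A * det C"
      and sum: "quadratic_gauss_sum n p t G = quadratic_gauss_sum 1 p t A * quadratic_gauss_sum s p t C"
      by (rule split_leading_block[OF assms(1) less.prems(1) _ less.prems(2), of t, unfolded r])
        (use False in blast)+
    let ?L = "\<lambda>a. Legendre a (int p)"
    \<comment> \<open>The inserted square of the symbol of \<open>u\<close> is 1; it allows
      \<open>det G\<close> to be replaced by \<open>u\<^sup>2 * det G\<close>, which
      factors.\<close>
    have "?L ((2 * t) ^ n * det G) = ?L u * ?L u * ?L ((2 * t) ^ n * det G)"
      using Legendre_square[of u "int p"] u(1) by (simp add: cong_0_iff)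
    also have "\<dots> = ?L ((2 * t) ^ n * (u\<^sup>2 * det G))"
      by (simp add: Legendre_mult[OF assms(1,2)] power2_eq_square)
    also have "\<dots> = ?L (2 * t * det A) * ?L ((2 * t) ^ s * det C)"
      unfolding u(2) n by (simp add: Legendre_mult[OF assms(1,2)])
    finally have "?L ((2 * t) ^ n * det G) = ?L (2 * t * det A) * ?L ((2 * t) ^ s * det C)" .
    then show ?thesis
      unfolding sum quadratic_gauss_sum_1[OF assms(1,2) AC(1,3) assms(3)]
        less.IH[OF _ AC(2,4), unfolded n, simplified]
      by (simp add: n)
  qed
qed

section \<open>Evaluation at the prime 2\<close>

lemma add_char_2: "add_char 2 a = (if even a then 1 else - 1)"
proof -
  have "add_char 2 a = cis (pi * of_int a)" by (simp add: add_char_def)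
  then show ?thesis by (auto simp: complex_eq_iff sin_npi_int cos_npi_int)
qed

lemma kronecker_prime_2_mult:
  "kronecker_prime (a * b) 2 = kronecker_prime a 2 * kronecker_prime b 2"
proof -
  consider "even a" | "even b" | "odd a" "odd b" by blast
  then show ?thesis
  proof cases
    case 3
    have "c mod 8 = 1 \<or> c mod 8 = 3 \<or> c mod 8 = 5 \<or> c mod 8 = 7" if "odd c" for c :: int
      using that by presburger
    then have "a mod 8 = 1 \<or> a mod 8 = 3 \<or> a mod 8 = 5 \<or> a mod 8 = 7"
      "b mod 8 = 1 \<or> b mod 8 = 3 \<or> b mod 8 = 5 \<or> b mod 8 = 7" using 3 by blast+
    moreover have "(a * b) mod 8 = (i * j) mod 8" if "a mod 8 = i" "b mod 8 = j" for i j
      unfolding that[symmetric] by (simp add: mod_mult_eq)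
    ultimately show ?thesis using 3
      by (elim disjE) (simp_all add: kronecker_prime_def)
  qed (simp_all add: kronecker_prime_def)
qed

text \<open>With diagonal 2a, 2c and odd off-diagonal entry b, the four terms add up to 2, except to
  -2 when a and c are both odd. Since b^2 is 1 modulo 8, the determinant 4ac - b^2 is 3 modulo 8 in
  the exceptional case and 7 otherwise.\<close>

lemma quadratic_gauss_sum_2:
  assumes "even_symmetric 2 A" "odd (det A)"
  shows "quadratic_gauss_sum 2 2 1 A = 2 * of_int (kronecker_prime (det A) 2)"
proof -
  note A = even_symmetricD[OF assms(1)]
  obtain a where a: "A $$ (0, 0) = 2 * a" using A(3)[of 0] by auto
  obtain c where c: "A $$ (1, 1) = 2 * c" using A(3)[of 1] by auto
  define b where "b = A $$ (0, 1)"
  have b': "A $$ (1, 0) = b" using A(4)[of 1 0] by (simp add: b_def)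
  have "A = mat 2 2 (\<lambda>ij. A $$ ij)" using A(1) by (intro eq_matI) auto
  then have det_A: "det A = 4 * (a * c) - b * b"
    using det_mat_2[of "\<lambda>ij. A $$ ij"] a c b' b_def by simp
  have b: "odd b" using assms(2) det_A by simp
  have form: "half_form A (vec 2 (\<lambda>i. if i = 0 then x else y)) = a * x * x + b * x * y + c * y * y"
    for x y
  proof -
    let ?v = "vec 2 (\<lambda>i. if i = 0 then x else y)"
    have "?v \<bullet> (A *\<^sub>v ?v) = (\<Sum>i<2. \<Sum>j<2. ?v $ i * A $$ (i, j) * ?v $ j)"
      by (rule quadratic_double_sum[OF A(1)]) simp
    also have "\<dots> = 2 * (a * x * x + b * x * y + c * y * y)"
      using a c b' b_def by (simp add: numeral_2_eq_2 algebra_simps)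
    finally show ?thesis by (simp add: half_form_def)
  qed
  have "{0..<int 2} = {0, 1}" by auto
  then have sum: "quadratic_gauss_sum 2 2 1 A =
      1 + add_char 2 a + add_char 2 c + add_char 2 (a + b + c)"
    unfolding quadratic_gauss_sum_def sum_residue_box_2 form by simp
  have "8 dvd b\<^sup>2 - 1"
  proof -
    obtain k where k: "b = 2 * k + 1" using b by (rule oddE)
    have "even (k * (k + 1))" by simp
    then obtain l where "k * (k + 1) = 2 * l" by (rule evenE)
    then have "b\<^sup>2 - 1 = 8 * l" unfolding k by (simp add: power2_eq_square algebra_simps)
    then show ?thesis by simp
  qed
  then obtain l where l: "b * b = 8 * l + 1"
    by (metis dvdE diff_add_cancel power2_eq_square)
  have "kronecker_prime (det A) 2 = (if odd a \<and> odd c then - 1 else 1)"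
  proof (cases "odd a \<and> odd c")
    case True
    then have "odd (a * c)" by simp
    then obtain k where "a * c = 2 * k + 1" by (rule oddE)
    then have "det A mod 8 = 3" unfolding det_A l by (simp only:) presburger
    then show ?thesis using True assms(2) by (simp add: kronecker_prime_def)
  next
    case False
    then have "even (a * c)" by simp
    then obtain k where "a * c = 2 * k" by (rule evenE)
    then have "det A mod 8 = 7" unfolding det_A l by (simp only:) presburger
    then show ?thesis using False assms(2) by (auto simp: kronecker_prime_def)
  qed
  then show ?thesis unfolding sum add_char_2 using b by auto
qed

text \<open>The frequency is fixed to 1, the only nonzero residue modulo 2. Each split block has
  size 2 and contributes a factor 2, which explains both the parity of \<open>n\<close> and the
  exponent \<open>n div 2\<close>.\<close>

lemma quadratic_gauss_sum_two:
  assumes "even_symmetric n G" "odd (det G)"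
  shows "even n \<and> quadratic_gauss_sum n 2 1 G = of_int (kronecker_prime (det G) 2) * 2 ^ (n div 2)"
  using assms
proof (induction n arbitrary: G rule: less_induct)
  case (less n)
  show ?case
  proof (cases "n = 0")
    case True
    have "det G = 1" using even_symmetricD(1)[OF less.prems(1)] True by (simp add: det_dim_zero)
    moreover have "half_form G vNil = 0"
      using even_symmetricD(1)[OF less.prems(1)] True by (simp add: half_form_def scalar_prod_def)
    ultimately show ?thesis using True
      by (simp add: quadratic_gauss_sum_def residue_box_0 kronecker_prime_def)
  next
    case False
    have r: "(if 2 = (2 :: nat) then 2 else 1) = (2 :: nat)" by simp
    have prems: "prime (2 :: nat)" "n > 0" "\<not> int 2 dvd det G" using False less.prems(2) by auto
    obtain s u A C where n: "n = 2 + s" and AC: "even_symmetric 2 A" "even_symmetric s C"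
      "\<not> int 2 dvd det A" "\<not> int 2 dvd det C"
      and u: "\<not> int 2 dvd u" "u\<^sup>2 * det G = det A * det C"
      and sum: "quadratic_gauss_sum n 2 1 G = quadratic_gauss_sum 2 2 1 A * quadratic_gauss_sum s 2 1 C"
      by (rule split_leading_block[OF prems(1) less.prems(1) prems(2,3), of 1, unfolded r]) blast
    have odd: "odd (det A)" "odd (det C)" "odd u" using AC(3,4) u(1) by simp_all
    let ?K = "\<lambda>a. kronecker_prime a 2"
    have "?K u * ?K u = 1" using odd(3) by (simp add: kronecker_prime_def)
    then have "?K (det G) = ?K (u\<^sup>2 * det G)"
      by (simp add: kronecker_prime_2_mult power2_eq_square)
    also have "\<dots> = ?K (det A) * ?K (det C)" unfolding u(2) by (rule kronecker_prime_2_mult)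
    finally show ?thesis
      unfolding sum quadratic_gauss_sum_2[OF AC(1) odd(1)]
      using less.IH[OF _ AC(2) odd(2)] by (simp add: n)
  qed
qed

section \<open>The level\<close>

lemma map_of_int_mult_iff:
  fixes G H :: "int mat"
  assumes G: "G \<in> carrier_mat n n" and H: "H \<in> carrier_mat n n"
  shows "map_mat rat_of_int G * map_mat rat_of_int H = of_nat N \<cdot>\<^sub>m 1\<^sub>m n \<longleftrightarrow> G * H = int N \<cdot>\<^sub>m 1\<^sub>m n"
proof -
  have "map_mat rat_of_int G * map_mat rat_of_int H = map_mat rat_of_int (G * H)"
    by (rule of_int_hom.mat_hom_mult[symmetric, OF G H])
  moreover have "of_nat N \<cdot>\<^sub>m 1\<^sub>m n = map_mat rat_of_int (int N \<cdot>\<^sub>m 1\<^sub>m n)"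
    by (intro eq_matI) auto
  moreover have "map_mat rat_of_int A = map_mat rat_of_int B \<longleftrightarrow> A = B" for A B
    using of_int_hom.mat_hom_inj[of A B] by metis
  ultimately show ?thesis by simp
qed

text \<open>Replaces the rational inverse in the definition by a matrix equation over the integers,
  so that the remaining arguments about the level use only adjugates.\<close>

lemma is_scaled_inverse_iff:
  assumes G: "G \<in> carrier_mat n n" and det: "det G \<noteq> 0"
  shows "is_scaled_inverse G N H \<longleftrightarrow> H \<in> carrier_mat n n \<and> G * H = int N \<cdot>\<^sub>m 1\<^sub>m n"
proof -
  let ?G = "map_mat rat_of_int G" and ?H = "map_mat rat_of_int H"
  have G': "?G \<in> carrier_mat n n" using G by simp
  have "det ?G \<noteq> 0" using det by simp
  then have unit: "?G \<in> Units (ring_mat TYPE(rat) n ())"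
    by (rule det_non_zero_imp_unit[OF G'])
  obtain B where B: "mat_inverse ?G = Some B"
    using mat_inverse(1)[OF G', of "()"] unit by (cases "mat_inverse ?G") auto
  have inv: "?G * B = 1\<^sub>m n" "B * ?G = 1\<^sub>m n" "B \<in> carrier_mat n n"
    using mat_inverse(2)[OF G' B] by auto
  have "?H = of_nat N \<cdot>\<^sub>m B \<longleftrightarrow> ?H \<in> carrier_mat n n \<and> ?G * ?H = of_nat N \<cdot>\<^sub>m 1\<^sub>m n"
  proof (intro iffI conjI)
    assume H: "?H = of_nat N \<cdot>\<^sub>m B"
    then show "?H \<in> carrier_mat n n" using inv(3) by simp
    show "?G * ?H = of_nat N \<cdot>\<^sub>m 1\<^sub>m n"
      unfolding H mult_smult_distrib[OF G' inv(3)] inv(1) ..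
  next
    assume H: "?H \<in> carrier_mat n n \<and> ?G * ?H = of_nat N \<cdot>\<^sub>m 1\<^sub>m n"
    have "?H = (B * ?G) * ?H" unfolding inv(2) using H by (metis left_mult_one_mat)
    also have "\<dots> = B * (?G * ?H)" by (rule assoc_mult_mat[OF inv(3) G']) (use H in blast)
    also have "\<dots> = of_nat N \<cdot>\<^sub>m B"
      using H mult_smult_distrib[OF inv(3) one_carrier_mat, of "of_nat N"] inv(3) by simp
    finally show "?H = of_nat N \<cdot>\<^sub>m B" .
  qed
  moreover have "?H \<in> carrier_mat n n \<longleftrightarrow> H \<in> carrier_mat n n" by simp
  ultimately show ?thesis
    unfolding is_scaled_inverse_def B using map_of_int_mult_iff[OF G, of H N] by auto
qed

lemma even_integral_iff:
  assumes "H \<in> carrier_mat n n"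
  shows "even_integral H \<longleftrightarrow> (\<forall>i<n. even (H $$ (i, i)))"
  using assms by (auto simp: even_integral_def)

lemma smult_mat_cancel:
  fixes A B :: "int mat"
  assumes "c \<noteq> 0" "c \<cdot>\<^sub>m A = c \<cdot>\<^sub>m B"
  shows "A = B"
proof (rule eq_matI)
  show "dim_row A = dim_row B" "dim_col A = dim_col B"
    using arg_cong[OF assms(2), of dim_row] arg_cong[OF assms(2), of dim_col] by simp_all
  then show "A $$ (i, j) = B $$ (i, j)" if "i < dim_row B" "j < dim_col B" for i j
    using that assms(1) arg_cong[OF assms(2), of "\<lambda>M. M $$ (i, j)"] by simp
qed

lemma scaled_inverse_unique:
  fixes G :: "int mat"
  assumes G: "G \<in> carrier_mat n n" "det G \<noteq> 0"
    and H: "H \<in> carrier_mat n n" "H' \<in> carrier_mat n n" "G * H = G * H'"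
  shows "H = H'"
proof -
  have "det G \<cdot>\<^sub>m K = adj_mat G * (G * K)" if "K \<in> carrier_mat n n" for K
    using that adj_mat[OF G(1)] G(1)
    by (simp add: assoc_mult_mat[symmetric, of _ n n _ n _ n] mult_smult_assoc_mat[of _ n n _ n])
  then have "det G \<cdot>\<^sub>m H = det G \<cdot>\<^sub>m H'" using H by simp
  then show ?thesis by (rule smult_mat_cancel[OF G(2)])
qed

text \<open>Transposing \<open>G * H\<close> shows that the transpose of \<open>H\<close> is a
  scaled inverse on the left. The adjugate moves it to the right of \<open>G\<close>, where
  uniqueness identifies it with \<open>H\<close>.\<close>

lemma scaled_inverse_symmetric:
  fixes G :: "int mat"
  assumes G: "G \<in> carrier_mat n n" "transpose_mat G = G" "det G \<noteq> 0"
    and H: "H \<in> carrier_mat n n" "G * H = c \<cdot>\<^sub>m 1\<^sub>m n"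
  shows "transpose_mat H = H"
proof (rule scaled_inverse_unique[OF G(1,3) _ H(1)])
  show H': "transpose_mat H \<in> carrier_mat n n" using H(1) by simp
  have "transpose_mat H * G = transpose_mat (G * H)"
    using transpose_mult[OF G(1) H(1)] G(2) by simp
  also have "\<dots> = c \<cdot>\<^sub>m 1\<^sub>m n" unfolding H(2) by (intro eq_matI) auto
  finally have TG: "transpose_mat H * G = c \<cdot>\<^sub>m 1\<^sub>m n" .
  have "det G \<cdot>\<^sub>m transpose_mat H = (transpose_mat H * G) * adj_mat G"
    using adj_mat[OF G(1)] G(1) H'
    by (simp add: assoc_mult_mat[of _ n n _ n _ n] mult_smult_distrib[of _ n n _ n])
  also have "\<dots> = c \<cdot>\<^sub>m adj_mat G"
    unfolding TG using adj_mat(1)[OF G(1)] by (simp add: mult_smult_assoc_mat[of _ n n _ n])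
  finally have "G * (det G \<cdot>\<^sub>m transpose_mat H) = G * (c \<cdot>\<^sub>m adj_mat G)" by (rule arg_cong)
  then have "det G \<cdot>\<^sub>m (G * transpose_mat H) = c \<cdot>\<^sub>m (det G \<cdot>\<^sub>m 1\<^sub>m n)"
    unfolding mult_smult_distrib[OF G(1) H'] mult_smult_distrib[OF G(1) adj_mat(1)[OF G(1)]]
      adj_mat(2)[OF G(1)] .
  also have "\<dots> = det G \<cdot>\<^sub>m (c \<cdot>\<^sub>m 1\<^sub>m n)" by (intro eq_matI) auto
  finally have "G * transpose_mat H = c \<cdot>\<^sub>m 1\<^sub>m n" by (rule smult_mat_cancel[OF G(3)])
  then show "G * transpose_mat H = G * H" using H(2) by simp
qed

lemma level_exists:
  assumes G: "G \<in> carrier_mat n n" "det G \<noteq> 0"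
  shows "\<exists>N>0. \<exists>H. is_scaled_inverse G N H \<and> even_integral H"
proof -
  \<comment> \<open>The adjugate clears all denominators, the sign makes the multiple of the
    identity positive, and the factor 2 makes the diagonal even.\<close>
  define H where "H = (2 * sgn (det G)) \<cdot>\<^sub>m adj_mat G"
  have H: "H \<in> carrier_mat n n" using adj_mat(1)[OF G(1)] by (simp add: H_def)
  have "G * H = int (nat (2 * \<bar>det G\<bar>)) \<cdot>\<^sub>m 1\<^sub>m n"
    unfolding H_def mult_smult_distrib[OF G(1) adj_mat(1)[OF G(1)]] adj_mat(2)[OF G(1)]
    by (intro eq_matI) (auto simp: sgn_if)
  then have "is_scaled_inverse G (nat (2 * \<bar>det G\<bar>)) H"
    using is_scaled_inverse_iff[OF G] H by blast
  moreover have "even_integral H"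
    unfolding even_integral_iff[OF H] using adj_mat(1)[OF G(1)] by (auto simp: H_def)
  moreover have "nat (2 * \<bar>det G\<bar>) > 0" using G(2) by simp
  ultimately show ?thesis by blast
qed

lemma level_properties:
  assumes "even_symmetric n G" "det G \<noteq> 0"
  shows "level G > 0" "even_symmetric n (G_perp G)" "G * G_perp G = int (level G) \<cdot>\<^sub>m 1\<^sub>m n"
    "\<And>N H. 0 < N \<Longrightarrow> H \<in> carrier_mat n n \<Longrightarrow> G * H = int N \<cdot>\<^sub>m 1\<^sub>m n \<Longrightarrow>
      (\<forall>i<n. even (H $$ (i, i))) \<Longrightarrow> level G \<le> N"
proof -
  note G = even_symmetricD[OF assms(1)]
  have "\<exists>N. N > 0 \<and> (\<exists>H. is_scaled_inverse G N H \<and> even_integral H)"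
    using level_exists[OF G(1) assms(2)] by blast
  from LeastI_ex[OF this] obtain H where
    H: "level G > 0" "is_scaled_inverse G (level G) H" "even_integral H"
    unfolding level_def by blast
  have H': "H \<in> carrier_mat n n" "G * H = int (level G) \<cdot>\<^sub>m 1\<^sub>m n"
    using H(2) is_scaled_inverse_iff[OF G(1) assms(2)] by auto
  have perp: "G_perp G = H"
    unfolding G_perp_def
    using H(2) H' is_scaled_inverse_iff[OF G(1) assms(2)] scaled_inverse_unique[OF G(1) assms(2)]
    by (intro the_equality) metis+
  show "level G > 0" by (rule H(1))
  show "even_symmetric n (G_perp G)" "G * G_perp G = int (level G) \<cdot>\<^sub>m 1\<^sub>m n"
    using H(3) H' scaled_inverse_symmetric[OF G(1,2) assms(2) H'] even_integral_iff[OF H'(1)]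
    by (auto simp: perp even_symmetric_def)
  show "level G \<le> N" if "0 < N" "K \<in> carrier_mat n n" "G * K = int N \<cdot>\<^sub>m 1\<^sub>m n"
    "\<forall>i<n. even (K $$ (i, i))" for N K
    unfolding level_def
    using that is_scaled_inverse_iff[OF G(1) assms(2), of N K] even_integral_iff[OF that(2)]
    by (intro Least_le) auto
qed

text \<open>Applied to \<open>G_perp G\<close>, this transfers divisibility of the level by a prime
  not dividing \<open>det G\<close> to every entry of \<open>G_perp G\<close>.\<close>

lemma adj_mult_scaled_inverse:
  fixes G :: "int mat"
  assumes "G \<in> carrier_mat n n" "H \<in> carrier_mat n n" "G * H = c \<cdot>\<^sub>m 1\<^sub>m n"
  shows "det G \<cdot>\<^sub>m H = c \<cdot>\<^sub>m adj_mat G"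
proof -
  note adj = adj_mat[OF assms(1)]
  have "det G \<cdot>\<^sub>m H = adj_mat G * G * H"
    unfolding adj(3) using assms(2) by (simp add: mult_smult_assoc_mat[of _ n n _ n])
  also have "\<dots> = adj_mat G * (c \<cdot>\<^sub>m 1\<^sub>m n)"
    unfolding assms(3)[symmetric] by (rule assoc_mult_mat[OF adj(1) assms(1,2)])
  also have "\<dots> = c \<cdot>\<^sub>m adj_mat G"
    using adj(1) by (simp add: mult_smult_distrib[of _ n n _ n])
  finally show ?thesis .
qed

text \<open>If \<open>p\<close> divided the level, then \<open>G_perp G\<close> would be \<open>p\<close> times an integer matrix \<open>K\<close>,
  and \<open>K\<close> would show that already \<open>level G div p\<close> clears the denominators.  The only delicate
  point is that the diagonal of \<open>K\<close> is even when \<open>p = 2\<close>.\<close>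

lemma prime_not_dvd_level:
  assumes es: "even_symmetric n G" and p: "prime p" "\<not> int p dvd det G"
  shows "\<not> p dvd level G"
proof
  assume "p dvd level G"
  then obtain N where N: "level G = p * N" by (rule dvdE)
  note G = even_symmetricD[OF es]
  have det: "det G \<noteq> 0" using p(2) by auto
  note level = level_properties[OF es det]
  note H = even_symmetricD[OF level(2)]
  let ?H = "G_perp G"
  have p': "prime (int p)" using p(1) by simp
  have N0: "N > 0" using level(1) N by simp
  have DH: "det G * ?H $$ (i, j) = int p * (int N * adj_mat G $$ (i, j))" if "i < n" "j < n" for i j
    using arg_cong[OF adj_mult_scaled_inverse[OF G(1) H(1) level(3)], of "\<lambda>M. M $$ (i, j)"]
      that H(1) adj_mat(1)[OF G(1)] by (simp add: N mult.assoc)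
  have dvd: "int p dvd ?H $$ (i, j)" if "i < n" "j < n" for i j
  proof -
    have "int p dvd det G * ?H $$ (i, j)" unfolding DH[OF that] by simp
    then show ?thesis using p(2) by (simp add: prime_dvd_mult_iff[OF p'])
  qed
  define K where "K = mat n n (\<lambda>(i, j). ?H $$ (i, j) div int p)"
  have K: "K \<in> carrier_mat n n" by (simp add: K_def)
  have H_eq: "?H = int p \<cdot>\<^sub>m K" using H(1) dvd by (intro eq_matI) (auto simp: K_def)
  have GK: "G * K = int N \<cdot>\<^sub>m 1\<^sub>m n"
  proof (rule smult_mat_cancel)
    have "int p \<cdot>\<^sub>m (G * K) = int (level G) \<cdot>\<^sub>m 1\<^sub>m n"
      using level(3) unfolding H_eq mult_smult_distrib[OF G(1) K] .
    also have "\<dots> = int p \<cdot>\<^sub>m (int N \<cdot>\<^sub>m 1\<^sub>m n)" by (intro eq_matI) (auto simp: N)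
    finally show "int p \<cdot>\<^sub>m (G * K) = int p \<cdot>\<^sub>m (int N \<cdot>\<^sub>m 1\<^sub>m n)" .
  qed (use prime_gt_0_nat[OF p(1)] in simp)
  have "even (K $$ (i, i))" if i: "i < n" for i
  proof (cases "p = 2")
    case False
    then have "odd (int p)" using p(1) prime_odd_nat[OF p(1)] prime_ge_2_nat[OF p(1)] by auto
    moreover have "even (int p * K $$ (i, i))"
      using H(3)[OF i] H_eq K i by simp
    ultimately show ?thesis by simp
  next
    case True
    show ?thesis
    proof (cases "even N")
      case True
      \<comment> \<open>Here \<open>det G\<close> is odd, so the parity of the even factor
        \<open>N\<close> passes to the diagonal entry.\<close>
      have "det G * K $$ (i, i) = int N * adj_mat G $$ (i, i)"
        using DH[OF i i] H_eq K i prime_gt_0_nat[OF p(1)] by simp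
      then have "even (det G * K $$ (i, i))" using True by simp
      then show ?thesis using p(2) \<open>p = 2\<close> by simp
    next
      case False
      \<comment> \<open>For the i-th column x of \<open>K\<close>, the equation
        \<open>G * K = N\<close> times the identity turns the even value of the form at x into N
        times \<open>K $$ (i, i)\<close>; for odd \<open>N\<close> the entry must be even.\<close>
      let ?x = "K *\<^sub>v unit_vec n i"
      have x: "?x \<in> carrier_vec n" using K by simp
      have "G *\<^sub>v ?x = int N \<cdot>\<^sub>v unit_vec n i"
        unfolding assoc_mult_mat_vec[symmetric, OF G(1) K unit_vec_carrier] GK
        by (intro eq_vecI) auto
      then have "?x \<bullet> (G *\<^sub>v ?x) = int N * (?x \<bullet> unit_vec n i)"
        using scalar_prod_smult_distrib[OF x unit_vec_carrier] by simp
      also have "?x \<bullet> unit_vec n i = K $$ (i, i)" using K i x by simp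
      finally show ?thesis using even_quadratic[OF es x] False by simp
    qed
  qed
  then have "level G \<le> N" using level(4)[OF N0 K GK] by blast
  then show False using N N0 prime_ge_2_nat[OF p(1)] by simp
qed

section \<open>Counting solutions\<close>

text \<open>The vector w is \<open>G_perp G *\<^sub>v v\<close> times an inverse of the level modulo
  \<open>p\<close>, so that G w is v modulo \<open>p\<close> and \<open>half_form G (x + w)\<close>
  completes the square. Then c = m + \<open>half_form G w\<close>, and c is one of the integers
  called t_m in the odd-dimensional formula.\<close>

lemma rep_count_square_completion:
  assumes es: "even_symmetric n G" and p: "prime p" "\<not> int p dvd det G"
    and v: "v \<in> carrier_vec n"
  obtains c where "[int (level G) * c = int (level G) * m + half_form (G_perp G) v] (mod int p)"
    "of_nat (rep_count G v p m) * of_nat p =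
      (\<Sum>t\<in>{0..<int p}. add_char p (- (t * c)) * quadratic_gauss_sum n p t G)"
proof -
  note G = even_symmetricD[OF es]
  have det: "det G \<noteq> 0" using p(2) by auto
  note level = level_properties[OF es det]
  note H = even_symmetricD[OF level(2)]
  let ?N = "int (level G)" and ?H = "G_perp G"
  have p0: "p > 0" using p(1) prime_gt_0_nat by blast
  have "coprime (int p) ?N"
    using prime_not_dvd_level[OF es p] p(1) by (simp add: prime_imp_coprime)
  then obtain N' where N': "[?N * N' = 1] (mod int p)"
    by (metis cong_solve_coprime_int coprime_commute)
  define w where "w = N' \<cdot>\<^sub>v (?H *\<^sub>v v)"
  have Hv: "?H *\<^sub>v v \<in> carrier_vec n" using H(1) v by simp
  have w: "w \<in> carrier_vec n" using Hv by (simp add: w_def)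
  have "G *\<^sub>v w = N' \<cdot>\<^sub>v (?N \<cdot>\<^sub>v v)"
  proof -
    have "G *\<^sub>v w = N' \<cdot>\<^sub>v (G *\<^sub>v (?H *\<^sub>v v))"
      unfolding w_def by (rule mult_mat_vec_smult[OF G(1) Hv])
    also have "G *\<^sub>v (?H *\<^sub>v v) = ?N \<cdot>\<^sub>v v"
      unfolding assoc_mult_mat_vec[symmetric, OF G(1) H(1) v] level(3)
      using v by (intro eq_vecI) auto
    finally show ?thesis .
  qed
  then have Gw: "G *\<^sub>v w = (?N * N') \<cdot>\<^sub>v v" by (simp add: smult_smult_assoc mult.commute)
  have "[(?N * N') * v $ i = 1 * v $ i] (mod int p)" for i
    using N' by (rule cong_scalar_right)
  then have Gw_v: "vec_cong (G *\<^sub>v w) v (int p)"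
    unfolding Gw vec_cong_def using v by auto
  have "2 * half_form G w = 2 * (?N * N' * N' * half_form ?H v)"
  proof -
    have "2 * half_form G w = w \<bullet> (G *\<^sub>v w)" by (rule two_half_form[OF es w])
    also have "\<dots> = ?N * N' * (N' * ((?H *\<^sub>v v) \<bullet> v))"
      unfolding Gw unfolding w_def using v Hv
      by (simp add: smult_scalar_prod_distrib[of _ n] scalar_prod_smult_distrib[of _ n])
    also have "(?H *\<^sub>v v) \<bullet> v = v \<bullet> (?H *\<^sub>v v)" by (rule comm_scalar_prod[OF Hv v])
    also have "\<dots> = 2 * half_form ?H v" using two_half_form[OF level(2) v] by simp
    finally show ?thesis by simp
  qed
  \<comment> \<open>The inverse N' occurs twice and N once in \<open>half_form G w\<close>; a
    further factor N pairs them into (N N')^2, which is 1 modulo \<open>p\<close>.\<close>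
  then have Qw: "?N * half_form G w = (?N * N') * (?N * N') * half_form ?H v" by simp
  define c where "c = m + half_form G w"
  have "[?N * half_form G w = 1 * 1 * half_form ?H v] (mod int p)"
    unfolding Qw by (intro cong_mult N' cong_refl)
  then have c: "[?N * c = ?N * m + half_form ?H v] (mod int p)"
    unfolding c_def distrib_left by (intro cong_add cong_refl) simp
  let ?B = "residue_box n p"
  let ?f = "\<lambda>x. \<Sum>t\<in>{0..<int p}. add_char p ((half_form G x - c) * t)"
  have f: "?f x = (if [half_form G x = c] (mod int p) then of_nat p else 0)" for x
    unfolding sum_add_char[OF p0] by (simp add: cong_diff_iff_cong_0)
  have shift: "[half_form G (x + w) = c] (mod int p) \<longleftrightarrow> [half_form G x + v \<bullet> x = m] (mod int p)"
    if x: "x \<in> carrier_vec n" for x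
  proof -
    have "[x \<bullet> (G *\<^sub>v w) = x \<bullet> v] (mod int p)"
      using x v w G(1) by (intro scalar_prod_cong Gw_v) (auto simp: vec_cong_def)
    also have "x \<bullet> v = v \<bullet> x" by (rule comm_scalar_prod[OF x v])
    finally have "[half_form G (x + w) = (half_form G x + v \<bullet> x) + half_form G w] (mod int p)"
      unfolding half_form_add[OF es x w] by (metis (no_types, lifting) add.assoc add.commute cong_add_lcancel)
    then have "[half_form G (x + w) = c] (mod int p) \<longleftrightarrow>
        [(half_form G x + v \<bullet> x) + half_form G w = m + half_form G w] (mod int p)"
      unfolding c_def by (metis cong_sym cong_trans)
    then show ?thesis by (simp add: cong_add_rcancel)
  qed
  have "of_nat (rep_count G v p m) * of_nat p =
      (\<Sum>x\<in>?B. if [half_form G x + v \<bullet> x = m] (mod int p) then of_nat p else (0 :: complex))"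
  proof -
    have "dim_row G = n" using G(1) by simp
    then have "rep_count G v p m = card {x\<in>?B. [half_form G x + v \<bullet> x = m] (mod int p)}"
      unfolding rep_count_def residue_box_def by (intro arg_cong[where f = card]) auto
    then show ?thesis
      using sum.inter_filter[OF finite_residue_box[of n p], of "\<lambda>_. of_nat p :: complex"
        "\<lambda>x. [half_form G x + v \<bullet> x = m] (mod int p)"] by simp
  qed
  also have "\<dots> = (\<Sum>x\<in>?B. ?f (1\<^sub>m n *\<^sub>v x + w))"
    unfolding f by (intro sum.cong refl) (use shift in \<open>auto dest: residue_box_carrier\<close>)
  also have "\<dots> = sum ?f ?B"
  proof (rule sum_residue_box_affine[OF p0 one_carrier_mat w])
    show "?f x = ?f y" if "x \<in> carrier_vec n" "y \<in> carrier_vec n" "vec_cong x y (int p)" for x y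
      unfolding f using half_form_cong[OF es that] by (metis cong_sym cong_trans)
  qed simp
  also have "\<dots> = (\<Sum>t\<in>{0..<int p}. \<Sum>x\<in>?B. add_char p ((half_form G x - c) * t))"
    by (rule sum.swap)
  also have "\<dots> = (\<Sum>t\<in>{0..<int p}. add_char p (- (t * c)) * quadratic_gauss_sum n p t G)"
    unfolding quadratic_gauss_sum_def sum_distrib_left
    by (intro sum.cong refl) (simp add: add_char_add[symmetric] algebra_simps)
  finally show thesis using that c by blast
qed

section \<open>The symbols and the root of unity in the final formulas\<close>

lemma kronecker_prime_denominator:
  assumes "prime p"
  shows "kronecker a (int p) = kronecker_prime a (int p)"
proof -
  have "prime_factorization (int p) = {#int p#}"
    using assms by (intro prime_factorization_prime) simp
  then show ?thesis using prime_gt_0_nat[OF assms] by (simp add: kronecker_def)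
qed

lemma kronecker_odd_prime:
  assumes "prime p" "p > 2"
  shows "kronecker a (int p) = Legendre a (int p)"
  using kronecker_prime_denominator[OF assms(1)] assms(2) by (simp add: kronecker_prime_def)

text \<open>With j = 2i and p = 2q + 1 the argument of \<open>e\<close> is -qi/2, so the value is
  (-1)^(qi). It is applied with j = n and j = n + 1, and agrees with a power of the Legendre symbol
  of -1.\<close>

lemma e_eighth:
  assumes "even j" "odd p"
  shows "e (of_nat j * (1 - of_nat p) / 8) = (- 1) ^ (((p - 1) div 2) * (j div 2))"
proof -
  obtain i where i: "j = 2 * i" using assms(1) by (rule evenE)
  obtain q where q: "p = 2 * q + 1" using assms(2) by (rule oddE)
  have "2 * of_real pi * \<i> * (of_nat j * (1 - of_nat p) / 8) = - (of_nat (q * i) * (of_real pi * \<i>))"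
    unfolding i q by (simp add: field_simps)
  then have "e (of_nat j * (1 - of_nat p) / 8) = inverse (exp (of_real pi * \<i>) ^ (q * i))"
    unfolding e_def exp_of_nat_mult[symmetric] by (simp add: exp_minus)
  also have "exp (of_real pi * \<i>) = - 1" by simp
  also have "inverse ((- 1) ^ (q * i)) = ((- 1) ^ (q * i) :: complex)"
    by (simp add: power_inverse[symmetric])
  also have "q * i = ((p - 1) div 2) * (j div 2)" by (simp add: i q)
  finally show ?thesis .
qed

text \<open>Taking determinants in \<open>G * G_perp G\<close> gives a power of the level; an odd
  level would make \<open>det G\<close> odd, which is impossible in odd dimension.\<close>

lemma level_even_if_odd_dim:
  assumes "even_symmetric n G" "odd n" "det G \<noteq> 0"
  shows "even (level G)"
proof (rule ccontr)
  assume "odd (level G)"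
  note level = level_properties[OF assms(1,3)]
  have "det G * det (G_perp G) = int (level G) ^ n"
    using det_mult[OF even_symmetricD(1)[OF assms(1)] even_symmetricD(1)[OF level(2)]]
    unfolding level(3) by simp
  then have "odd (det G)" using \<open>odd (level G)\<close> by (metis even_mult_iff even_of_nat even_power)
  then show False using quadratic_gauss_sum_two[OF assms(1)] assms(2) by blast
qed

section \<open>Summation over the frequencies\<close>

lemma card_residue_box: "card (residue_box n p) = p ^ n"
proof (induction n)
  case (Suc n)
  have "card (residue_box (n + 1) p) = card (residue_box n p \<times> residue_box 1 p)"
    by (rule bij_betw_same_card[symmetric, OF residue_box_append])
  also have "card (residue_box 1 p) = p"
    using sum_residue_box_1[of "\<lambda>_. 1 :: nat" p] by simp
  then have "card (residue_box n p \<times> residue_box 1 p) = p ^ n * p"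
    by (simp only: card_cartesian_product Suc.IH)
  finally show ?case by simp
qed (simp add: residue_box_0)

text \<open>The zero frequency counts all vectors; divided by \<open>p\<close> it becomes the main
  term p^(n-1) of all three formulas.\<close>

lemma sum_quadratic_gauss_sum_split:
  assumes "p > 0"
  shows "(\<Sum>t\<in>{0..<int p}. add_char p (- (t * c)) * quadratic_gauss_sum n p t G) =
    of_nat p ^ n + (\<Sum>t\<in>{1..<int p}. add_char p (- (t * c)) * quadratic_gauss_sum n p t G)"
proof -
  have "{0..<int p} = insert 0 {1..<int p}" using assms by auto
  then show ?thesis by (simp add: quadratic_gauss_sum_def card_residue_box)
qed

lemma Legendre_even_power:
  assumes "prime p" "p > 2" "\<not> int p dvd a" "even n"
  shows "Legendre a (int p) ^ n = 1"
proof -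
  obtain i where "n = 2 * i" using assms(4) by (rule evenE)
  moreover have "Legendre a (int p) ^ 2 = 1"
    using Legendre_square[of a "int p"] assms(3) by (simp add: cong_0_iff power2_eq_square)
  ultimately show ?thesis by (simp add: power_mult)
qed

lemma not_dvd_double:
  assumes "prime p" "p > 2" "t \<in> {1..<int p}"
  shows "\<not> int p dvd t" "\<not> int p dvd 2 * t"
proof -
  show t: "\<not> int p dvd t" using assms(3) zdvd_not_zless[of t "int p"] by simp
  have "\<not> int p dvd 2" using assms(2) zdvd_not_zless[of 2 "int p"] by simp
  moreover have "prime (int p)" using assms(1) by simp
  ultimately show "\<not> int p dvd 2 * t" using t prime_dvd_mult_iff by blast
qed

lemma gauss_sum_even_power:
  assumes "prime p" "p > 2" "even j"
  shows "gauss_sum p 1 ^ j = of_int (Legendre (- 1) (int p)) ^ (j div 2) * of_nat p ^ (j div 2)"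
proof -
  have "gauss_sum p 1 ^ j = (gauss_sum p 1 ^ 2) ^ (j div 2)"
    using assms(3) by (simp add: power_mult[symmetric])
  then show ?thesis unfolding gauss_sum_square[OF assms(1,2)] by (simp add: power_mult_distrib)
qed

text \<open>For even \<open>n\<close> the factor (2t)^n is a square, so the Gauss sum is the same
  for all nonzero t. What remains is the character sum over nonzero t, which is p - 1 or -1
  according to whether \<open>p\<close> divides c.\<close>

lemma rep_count_even_dim_odd_prime:
  assumes es: "even_symmetric n G" and p: "prime p" "p > 2" "\<not> int p dvd det G"
    and n: "even n" "n > 0"
    and sum: "of_nat R * of_nat p =
      (\<Sum>t\<in>{0..<int p}. add_char p (- (t * c)) * quadratic_gauss_sum n p t G)"
  shows "(of_nat R :: complex) = of_nat p ^ (n - 1) + of_int (Legendre (det G) (int p)) *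
    of_int (Legendre (- 1) (int p)) ^ (n div 2) * of_nat p ^ (n div 2 - 1) *
    ((if [c = 0] (mod int p) then 1 else 0) * of_nat p - 1)"
proof -
  have p0: "p > 0" using p(2) by simp
  let ?L = "\<lambda>a. of_int (Legendre a (int p)) :: complex"
  let ?\<delta> = "(if [c = 0] (mod int p) then 1 else 0) * of_nat p - 1 :: complex"
  have S: "quadratic_gauss_sum n p t G = ?L (det G) * gauss_sum p 1 ^ n" if "t \<in> {1..<int p}" for t
  proof -
    note t = not_dvd_double[OF p(1,2) that]
    have "Legendre ((2 * t) ^ n * det G) (int p) =
        Legendre (2 * t) (int p) ^ n * Legendre (det G) (int p)"
      by (simp only: Legendre_mult[OF p(1,2), of _ "det G"] Legendre_power[OF p(1,2)])
    also have "\<dots> = Legendre (det G) (int p)"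
      by (simp only: Legendre_even_power[OF p(1,2) t(2) n(1)] mult_1)
    finally have "Legendre ((2 * t) ^ n * det G) (int p) = Legendre (det G) (int p)" .
    then show ?thesis
      unfolding quadratic_gauss_sum_odd_prime[OF p(1,2) t(1) es p(3)] by simp
  qed
  have "(\<Sum>t\<in>{1..<int p}. add_char p (- (t * c))) = ?\<delta>"
  proof -
    have "{0..<int p} = insert 0 {1..<int p}" using p0 by auto
    then have "1 + (\<Sum>t\<in>{1..<int p}. add_char p (- c * t)) = (if [- c = 0] (mod int p) then of_nat p else 0)"
      using sum_add_char[OF p0, of "- c"] by simp
    moreover have "[- c = 0] (mod int p) \<longleftrightarrow> [c = 0] (mod int p)" by (simp add: cong_0_iff)
    ultimately show ?thesis by (simp add: mult.commute algebra_simps)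
  qed
  moreover have "(\<Sum>t\<in>{1..<int p}. add_char p (- (t * c)) * quadratic_gauss_sum n p t G) =
      ?L (det G) * gauss_sum p 1 ^ n * (\<Sum>t\<in>{1..<int p}. add_char p (- (t * c)))"
    unfolding sum_distrib_left by (rule sum.cong[OF refl]) (simp only: S mult_ac)
  ultimately have "of_nat R * of_nat p = of_nat p ^ n + ?L (det G) * gauss_sum p 1 ^ n * ?\<delta>"
    unfolding sum sum_quadratic_gauss_sum_split[OF p0] by (simp only:)
  also have "gauss_sum p 1 ^ n = ?L (- 1) ^ (n div 2) * of_nat p ^ (n div 2)"
    by (rule gauss_sum_even_power[OF p(1,2) n(1)])
  also have "of_nat p ^ n + ?L (det G) * (?L (- 1) ^ (n div 2) * of_nat p ^ (n div 2)) * ?\<delta> =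
      (of_nat p ^ (n - 1) + ?L (det G) * ?L (- 1) ^ (n div 2) * of_nat p ^ (n div 2 - 1) * ?\<delta>) * of_nat p"
  proof -
    have "of_nat p ^ n = of_nat p ^ (n - 1) * (of_nat p :: complex)"
      using n(2) by (metis power_minus_mult)
    \<comment> \<open>Since \<open>n\<close> is even and positive, \<open>n div 2\<close> is at
      least 1, so the truncated subtraction in the exponent is exact.\<close>
    moreover have "of_nat p ^ (n div 2) = of_nat p ^ (n div 2 - 1) * (of_nat p :: complex)"
      using n by (metis power_minus_mult div_greater_zero_iff dvd_imp_le zero_less_numeral)
    ultimately show ?thesis by (simp only: distrib_right mult.assoc) (simp only: mult.commute)
  qed
  finally show ?thesis using p0 by simp
qed

text \<open>For odd \<open>n\<close> the symbol of (2t)^n is that of 2t. The symbol of t turns the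
  sum over frequencies into \<open>gauss_sum p (- c)\<close>, which supplies both the symbol of -c
  and the Gauss sum that makes the exponent even.\<close>

lemma rep_count_odd_dim:
  assumes es: "even_symmetric n G" and p: "prime p" "p > 2" "\<not> int p dvd det G"
    and n: "odd n"
    and sum: "of_nat R * of_nat p =
      (\<Sum>t\<in>{0..<int p}. add_char p (- (t * c)) * quadratic_gauss_sum n p t G)"
  shows "(of_nat R :: complex) = of_nat p ^ (n - 1) + of_int (Legendre (2 * det G) (int p)) *
    of_int (Legendre (- c) (int p)) * of_int (Legendre (- 1) (int p)) ^ ((n + 1) div 2) *
    of_nat p ^ ((n - 1) div 2)"
proof -
  have p0: "p > 0" using p(2) by simp
  let ?L = "\<lambda>a. of_int (Legendre a (int p)) :: complex"
  have S: "quadratic_gauss_sum n p t G = ?L (2 * det G) * gauss_sum p 1 ^ n * ?L t"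
    if "t \<in> {1..<int p}" for t
  proof -
    note t = not_dvd_double[OF p(1,2) that]
    obtain j where j: "n = Suc j" "even j" using n by (cases n) auto
    have "Legendre ((2 * t) ^ n * det G) (int p) = Legendre (2 * t * det G) (int p)"
      using Legendre_even_power[OF p(1,2) t(2) j(2)]
      by (simp add: j(1) Legendre_mult[OF p(1,2)] Legendre_power[OF p(1,2)] power_mult_distrib)
    also have "\<dots> = Legendre (2 * det G) (int p) * Legendre t (int p)"
      by (simp add: Legendre_mult[OF p(1,2)])
    finally show ?thesis
      unfolding quadratic_gauss_sum_odd_prime[OF p(1,2) t(1) es p(3)] by simp
  qed
  have "(\<Sum>t\<in>{1..<int p}. ?L t * add_char p (- (t * c))) = ?L (- c) * gauss_sum p 1"
  proof -
    \<comment> \<open>The frequency 0 can be put back without effect because its Legendre symbol is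
      0.\<close>
    have "{0..<int p} = insert 0 {1..<int p}" using p0 by auto
    then have "(\<Sum>t\<in>{1..<int p}. ?L t * add_char p (- c * t)) = gauss_sum p (- c)"
      unfolding gauss_sum_def by (simp add: Legendre_def)
    then show ?thesis using gauss_sum_eq[OF p(1,2), of "- c"] by (simp add: mult.commute)
  qed
  moreover have "(\<Sum>t\<in>{1..<int p}. add_char p (- (t * c)) * quadratic_gauss_sum n p t G) =
      ?L (2 * det G) * gauss_sum p 1 ^ n * (\<Sum>t\<in>{1..<int p}. ?L t * add_char p (- (t * c)))"
    unfolding sum_distrib_left by (rule sum.cong[OF refl]) (simp only: S mult_ac)
  ultimately have "of_nat R * of_nat p =
      of_nat p ^ n + ?L (2 * det G) * gauss_sum p 1 ^ n * (?L (- c) * gauss_sum p 1)"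
    unfolding sum sum_quadratic_gauss_sum_split[OF p0] by (simp only:)
  also have "\<dots> = of_nat p ^ n + ?L (2 * det G) * ?L (- c) * gauss_sum p 1 ^ (n + 1)"
    by simp
  also have "gauss_sum p 1 ^ (n + 1) = ?L (- 1) ^ ((n + 1) div 2) * of_nat p ^ ((n + 1) div 2)"
    by (rule gauss_sum_even_power[OF p(1,2)]) (use n in simp)
  also have "of_nat p ^ n + ?L (2 * det G) * ?L (- c) *
        (?L (- 1) ^ ((n + 1) div 2) * of_nat p ^ ((n + 1) div 2)) =
      (of_nat p ^ (n - 1) + ?L (2 * det G) * ?L (- c) * ?L (- 1) ^ ((n + 1) div 2) *
        of_nat p ^ ((n - 1) div 2)) * of_nat p"
  proof -
    obtain i where "n = 2 * i + 1" using n by (rule oddE)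
    then have "of_nat p ^ n = of_nat p ^ (n - 1) * (of_nat p :: complex)"
      "of_nat p ^ ((n + 1) div 2) = of_nat p ^ ((n - 1) div 2) * (of_nat p :: complex)" by simp_all
    then show ?thesis by (simp only: distrib_right mult.assoc)
  qed
  finally show ?thesis using p0 by simp
qed

lemma rep_count_two:
  assumes es: "even_symmetric n G" and n: "even n" "n > 0" and det: "odd (det G)"
    and sum: "of_nat R * of_nat 2 =
      (\<Sum>t\<in>{0..<int 2}. add_char 2 (- (t * c)) * quadratic_gauss_sum n 2 t G)"
  shows "real R = 2 ^ (n - 1) +
    of_int (kronecker_prime (det G) 2) * (if even c then 1 else - 1) * 2 ^ (n div 2 - 1)"
proof -
  let ?K = "kronecker_prime (det G) 2"
  have "{1..<int 2} = {1}" by auto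
  moreover have "(2 :: nat) > 0" by simp
  note sum[unfolded sum_quadratic_gauss_sum_split[OF this]]
  ultimately have "of_nat R * 2 =
      2 ^ n + (if even c then 1 else - 1) * (of_int ?K * 2 ^ (n div 2) :: complex)"
    using quadratic_gauss_sum_two[OF es det] by (simp add: add_char_2)
  then have "complex_of_real (real R * 2) =
      complex_of_real (2 ^ n + (if even c then 1 else - 1) * (of_int ?K * 2 ^ (n div 2)))"
    by simp
  then have "real R * 2 = 2 ^ n + (if even c then 1 else - 1) * (of_int ?K * 2 ^ (n div 2))"
    by (simp only: of_real_eq_iff)
  moreover obtain i where "n = 2 * Suc i" using n by (metis evenE gr0_implies_Suc mult_0_right neq0_conv)
  ultimately show ?thesis by (cases "even c") simp_all
qed

theorem theorem1p5:
  fixes n :: nat and G :: "int mat" and v :: "int vec" and m :: int and p :: nat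
  assumes "n \<ge> 1"
    and "G \<in> carrier_mat n n"
    and "transpose_mat G = G"
    and "even_integral G"
    and "det G \<noteq> 0"
    and "v \<in> carrier_vec n"
    and "prime p"
    and "\<not> int p dvd det G"
  defines "N \<equiv> int (level G)"
    and "D \<equiv> det G"
    and "k \<equiv> int (level G) * m + half_form (G_perp G) v"
  shows
    "(even n \<and> p > 2 \<longrightarrow>
       (of_nat (rep_count G v p m) :: complex) =
         of_nat p ^ (n - 1) +
         of_int (kronecker D (int p)) * e (of_nat n * (1 - of_nat p) / 8) *
           of_nat p ^ (n div 2 - 1) *
           ((if [k = 0] (mod int p) then 1 else 0) * of_nat p - 1)) \<and>
     (even n \<and> p = 2 \<longrightarrow>
       real (rep_count G v p m) =
         2 ^ (n - 1) + of_int (kronecker D 2) * (-1) powi k * 2 ^ (n div 2 - 1)) \<and>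
     (odd n \<longrightarrow>
       even N \<and> p > 2 \<and>
       (\<forall>t::int. [N * t = k] (mod int p) \<longrightarrow>
         (of_nat (rep_count G v p m) :: complex) =
           of_nat p ^ (n - 1) +
           of_int (kronecker (2 * D) (int p)) * of_int (kronecker (- t) (int p)) *
             e (of_nat (n + 1) * (1 - of_nat p) / 8) *
             of_nat p ^ ((n - 1) div 2)))"
proof -
  note p = \<open>prime p\<close> \<open>\<not> int p dvd det G\<close>
  have es: "even_symmetric n G"
    using assms(2-4) even_integral_iff[OF assms(2)] by (simp add: even_symmetric_def)
  obtain c where c: "[N * c = k] (mod int p)" and
    sum: "of_nat (rep_count G v p m) * of_nat p =
      (\<Sum>t\<in>{0..<int p}. add_char p (- (t * c)) * quadratic_gauss_sum n p t G)"
    using rep_count_square_completion[OF es p assms(6)] unfolding N_def k_def by metis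
  have cop: "coprime N (int p)"
    using prime_not_dvd_level[OF es p] p(1) unfolding N_def
    by (simp add: prime_imp_coprime coprime_commute)
  have sign: "e (of_nat j * (1 - of_nat p) / 8) = of_int (Legendre (- 1) (int p)) ^ (j div 2)"
    if "even j" "p > 2" for j
    unfolding e_eighth[OF that(1) prime_odd_nat[OF p(1) that(2)]] Legendre_minus_1[OF p(1) that(2)]
    by (simp add: power_mult)
  show ?thesis
  proof (intro conjI impI allI; (elim conjE)?)
    assume n: "even n" and p2: "p > 2"
    \<comment> \<open>The level is a unit modulo \<open>p\<close>, so k, which is N c modulo
      \<open>p\<close>, vanishes exactly when c does.\<close>
    have "[k = 0] (mod int p) \<longleftrightarrow> [N * c = N * 0] (mod int p)"
      using c by (metis cong_sym cong_trans mult_zero_right)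
    also have "\<dots> \<longleftrightarrow> [c = 0] (mod int p)" using cop by (rule cong_mult_lcancel)
    finally have k: "[k = 0] (mod int p) \<longleftrightarrow> [c = 0] (mod int p)" .
    have "n > 0" using assms(1) by simp
    from rep_count_even_dim_odd_prime[OF es p(1) p2 p(2) n this sum]
    show "(of_nat (rep_count G v p m) :: complex) =
         of_nat p ^ (n - 1) +
         of_int (kronecker D (int p)) * e (of_nat n * (1 - of_nat p) / 8) *
           of_nat p ^ (n div 2 - 1) *
           ((if [k = 0] (mod int p) then 1 else 0) * of_nat p - 1)"
      unfolding k sign[OF n p2] kronecker_odd_prime[OF p(1) p2] D_def .
  next
    assume n: "even n" and p2: "p = 2"
    have "odd N" using cop unfolding p2 by simp
    then have "even k \<longleftrightarrow> even c"
      using c unfolding p2 by (simp add: cong_iff_dvd_diff)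
    then have k: "(- 1) powi k = (if even c then 1 else - 1 :: real)"
      by (simp add: power_int_minus_left)
    have "n > 0" "odd (det G)" using assms(1) p(2) p2 by simp_all
    from rep_count_two[OF es n this sum[unfolded p2]]
    show "real (rep_count G v p m) =
         2 ^ (n - 1) + of_int (kronecker D 2) * (-1) powi k * 2 ^ (n div 2 - 1)"
      using kronecker_prime_denominator[OF p(1), of D] unfolding k p2 D_def by simp
  next
    assume n: "odd n"
    show "even N" using level_even_if_odd_dim[OF es n assms(5)] by (simp add: N_def)
    \<comment> \<open>For p = 2 the determinant would be odd, which forces even dimension.\<close>
    have "p \<noteq> 2" using quadratic_gauss_sum_two[OF es] n p(2) by auto
    then show p2: "p > 2" using prime_ge_2_nat[OF p(1)] by simp
    fix t assume "[N * t = k] (mod int p)"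
    then have "[N * t = N * c] (mod int p)" using c cong_sym cong_trans by blast
    \<comment> \<open>Cancelling the unit N shows that every admissible t is congruent to c, so the
      choice of t does not affect the symbol.\<close>
    then have "[t = c] (mod int p)" using cop by (simp add: cong_mult_lcancel)
    then have t: "Legendre (- t) (int p) = Legendre (- c) (int p)"
      by (intro Legendre_cong) (simp add: cong_minus_minus_iff)
    have n1: "even (n + 1)" using n by simp
    from rep_count_odd_dim[OF es p(1) p2 p(2) n sum]
    show "(of_nat (rep_count G v p m) :: complex) =
           of_nat p ^ (n - 1) +
           of_int (kronecker (2 * D) (int p)) * of_int (kronecker (- t) (int p)) *
             e (of_nat (n + 1) * (1 - of_nat p) / 8) *
             of_nat p ^ ((n - 1) div 2)"
      unfolding sign[OF n1 p2] kronecker_odd_prime[OF p(1) p2] t D_def .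
  qed
qed

end
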